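(* Let $F=f+r$ on $\mathbb{R}^d$, stochastic models $f_x(\cdot;\xi)$ of $f$, and stochastic distance generating functions $\widetilde\omega(\cdot;\xi)$ of $\omega$ satisfy the standing conditions of the context (basic conditions with constants $\rho,\tau>0$, composite Lipschitz condition with constant $L>0$, and lower bound on the stochastic Bregman distance with function $c:\mathbb{N}\to(0,1]$). Fix $\lambda\in\big(0,\frac1{\rho+\tau}\big)$, let $K\ge1$, and let the method described in the context be run for $K$ iterations from $x^0\in\operatorname{dom}r$ with constant batch size $m_k\equiv m$ and constant step size $t_k\equiv t$, where $$\frac{\lambda(1-c(m))}{1-\lambda\tau-\lambda\rho c(m)}<t<\frac1\rho.$$ Then the returned point $x^{\bar k}$, where $\mathbb{P}(\bar k=k)=1/K$ for $k=0,\dots,K-1$, satisfies, with $\hat x^{k}:=\operatorname{prox}^\omega_{\lambda F}(x^{k})$, $$\mathbb{E}\big[D^{\mathrm{sym}}_{\omega,\lambda}(\hat x^{\bar k},x^{\bar k})\big]\le\frac{F^\omega_\lambda(x^0)-F^*}{\Gamma K}+\frac{t^2L^2}{4\lambda c(m)(1-t\rho)\Gamma},$$ where $$\Gamma:=\frac1{c(m)}\Big(\frac{t(1-\lambda(\rho+\tau))}{1-t\rho}-\lambda(1-c(m))\Big).$$ In particular, if $K>1$, $t=\frac1{\rho\sqrt K}$, and the minibatch size $m=m(K)$ satisfies $1-c(m)\le\frac{1-\lambda(\rho+\tau)}{2\lambda\rho\sqrt K}$, then $$\mathbb{E}\big[D^{\mathrm{sym}}_{\omega,\lambda}(\hat x^{\bar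 k},x^{\bar k})\big]\le\frac1{\sqrt K}\left(\frac{2\rho\,(F^\omega_\lambda(x^0)-F^* )}{1-\lambda(\rho+\tau)}+\frac{L^2}{2\lambda\rho\,(1-\lambda(\rho+\tau))}\right).$$
   Context: Norm and inner product are Euclidean; a function $h$ is $1$-strongly convex if $h-\frac12\|\cdot\|^2$ is convex. $D_\omega(y,x):=\omega(y)-\omega(x)-\langle\nabla\omega(x),y-x\rangle$. A proper lower semicontinuous $\varphi$ is $\rho\omega$-relatively weakly convex if $\varphi+\rho\omega$ is convex. $F^\omega_\lambda(x):=\min_y\{F(y)+\frac1\lambda D_\omega(y,x)\}$ and $\operatorname{prox}^\omega_{\lambda F}(x)$ is the corresponding minimizer (single-valued for $\lambda\in(0,1/(\rho+\tau))$). $D^{\mathrm{sym}}_{\omega,\lambda}(u,x):=\frac1{\lambda^2}(D_\omega(u,x)+D_\omega(x,u))$. $\operatorname{dom}r:=\{x:r(x)<\infty\}$. Setting. $(\Omega,\mathcal F,P)$ is a probability space; $f(x):=\mathbb{E}_{\xi\sim P}[f(x;\xi)]$; $r:\mathbb{R}^d\to\mathbb{R}$; $F:=f+r$; $F^*:=\inf F>-\infty$. $r$ is proper lower semicontinuous; $(x,y,\xi)\mapsto f_x(y;\xi)$ is jointly measurable; $F_x(\cdot;\xi):=f_x(\cdot;\xi)+r(\cdot)$ is proper and lower semicontinuous for every $x$ and almost every $\xi$. $\omega:\mathbb{R}^d\to\mathbb{R}$ is differentiable. Basic conditions (constants $\rho,\tau>0$). (1) $(x,\xi)\mapsto\widetilde\omega(x;\xi)$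 and $(x,\xi)\mapsto\widetilde\nabla\omega(x;\xi)$ are jointly measurable; for almost every $\xi$, $\widetilde\omega(\cdot;\xi)$ is differentiable and $1$-strongly convex with gradient $\widetilde\nabla\omega(x;\xi)=\nabla\widetilde\omega(x;\xi)$; and $\mathbb{E}_\xi|\widetilde\omega(x;\xi)|+\mathbb{E}_\xi\|\widetilde\nabla\omega(x;\xi)\|<\infty$, $\mathbb{E}_\xi[\widetilde\omega(x;\xi)]=\omega(x)$, $\mathbb{E}_\xi[\widetilde\nabla\omega(x;\xi)]=\nabla\omega(x)$. The stochastic Bregman distance is $\widetilde D_\omega(x,y;\xi):=\widetilde\omega(x;\xi)-\widetilde\omega(y;\xi)-\langle\widetilde\nabla\omega(y;\xi),x-y\rangle$. (2) For all $x,y$: $\mathbb{E}_\xi[f_x(x;\xi)]=f(x)$ and $\mathbb{E}_\xi[f_x(y;\xi)-f(y)]\le\tau\min\{D_\omega(x,y),D_\omega(y,x)\}$. (3) For every $x$ and almost every $\xi$, $f_x(\cdot;\xi)+r(\cdot)$ is $\rho\widetilde\omega(\cdot;\xi)$-relatively weakly convex. Composite Lipschitz condition. There are a measurable $\widetilde L:\mathbb{R}^d\times\Omega\to\mathbb{R}_+$ and $L>0$ with $\sqrt{\mathbb{E}_\xi[\widetilde L^2(x;\xi)]}\le L$ and, for all $x,y$ and almost every $\xi$, $F_x(x;\xi)-F_x(y;\xi)\le\widetilde L(x;\xi)\sqrt{\min\{\widetilde D_\omega(x,y;\xi),\widetilde D_\omega(y,x;\xi)\}}$. Method. Given step sizes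 $t_k>0$ and batch sizes $m_k$: at iteration $k=0,\dots,K-1$ draw a minibatch $\mathcal B_k=\{\xi_{k,1},\dots,\xi_{k,m_k}\}$ of i.i.d. samples from $P$ (independent of the past) and set $$x^{k+1}=\operatorname*{arg\,min}_y\frac1{m_k}\sum_{i=1}^{m_k}\Big(f_{x^k}(y;\xi_{k,i})+r(y)+\frac1{t_k}\widetilde D_\omega(y,x^k;\xi_{k,i})\Big);$$ finally return $x^{\bar k}$ with $\mathbb{P}(\bar k=k)=t_k/\sum_{i=0}^{K-1}t_i$. Write $\widetilde D_\omega(x,y;\mathcal B_k):=\frac1{m_k}\sum_{i=1}^{m_k}\widetilde D_\omega(x,y;\xi_{k,i})$ and let $\mathbb{E}_k$ be conditional expectation given $\mathcal B_0,\dots,\mathcal B_{k-1}$. Lower bound on the stochastic Bregman distance. There is $c:\mathbb{N}\to(0,1]$ with $\lim_{m\to\infty}c(m)=1$ such that for each iteration $k$, $\mathbb{E}_k[\widetilde D_\omega(\hat x^k,x^{k+1};\mathcal B_k)]\ge c(m_k)\,\mathbb{E}_k[D_\omega(\hat x^k,x^{k+1})]$, where $\hat x^k:=\operatorname{prox}^\omega_{\lambda F}(x^k)$. *)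

theory Defs
  imports "HOL-Probability.Probability"
begin

section \<open>Extended-real valued functions\<close>

definition proper_fun :: "('v \<Rightarrow> ereal) \<Rightarrow> bool" where
  "proper_fun \<phi> \<longleftrightarrow> (\<exists>x. \<phi> x < \<infinity>) \<and> (\<forall>x. - \<infinity> < \<phi> x)"

definition lsc_fun :: "('v :: topological_space \<Rightarrow> ereal) \<Rightarrow> bool" where
  "lsc_fun \<phi> \<longleftrightarrow> (\<forall>x. \<phi> x \<le> Liminf (at x) \<phi>)"

definition edom :: "('v \<Rightarrow> ereal) \<Rightarrow> 'v set" where
  "edom \<phi> = {x. \<phi> x < \<infinity>}"

text \<open>Meant for functions that do not take the value \<open>- \<infinity>\<close>; recall that
  \<open>0 * \<infinity> = 0\<close> in \<^typ>\<open>ereal\<close>, so the cases \<open>u = 0\<close> and \<open>v = 0\<close> are harmless.\<close>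

definition econvex :: "('v :: real_vector \<Rightarrow> ereal) \<Rightarrow> bool" where
  "econvex \<phi> \<longleftrightarrow> (\<forall>x y. \<forall>u\<ge>0. \<forall>v\<ge>0. u + v = 1 \<longrightarrow>
      \<phi> (u *\<^sub>R x + v *\<^sub>R y) \<le> ereal u * \<phi> x + ereal v * \<phi> y)"

definition rel_weakly_convex :: "real \<Rightarrow> ('v :: real_vector \<Rightarrow> real) \<Rightarrow> ('v \<Rightarrow> ereal) \<Rightarrow> bool" where
  "rel_weakly_convex \<rho> h \<phi> \<longleftrightarrow> econvex (\<lambda>x. \<phi> x + ereal (\<rho> * h x))"

definition one_strongly_convex :: "('v :: real_inner \<Rightarrow> real) \<Rightarrow> bool" where
  "one_strongly_convex h \<longleftrightarrow> convex_on UNIV (\<lambda>x. h x - (norm x)\<^sup>2 / 2)"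

section \<open>Bregman distances, envelopes and proximal points\<close>

definition grad :: "('v :: real_inner \<Rightarrow> real) \<Rightarrow> 'v \<Rightarrow> 'v" where
  "grad h x = (THE g. GDERIV h x :> g)"

definition bregman :: "('v :: real_inner \<Rightarrow> real) \<Rightarrow> 'v \<Rightarrow> 'v \<Rightarrow> real" where
  "bregman \<omega> y x = \<omega> y - \<omega> x - grad \<omega> x \<bullet> (y - x)"

definition bregman_sym :: "('v :: real_inner \<Rightarrow> real) \<Rightarrow> real \<Rightarrow> 'v \<Rightarrow> 'v \<Rightarrow> real" where
  "bregman_sym \<omega> lam u x = (1 / lam\<^sup>2) * (bregman \<omega> u x + bregman \<omega> x u)"

definition bregman_env ::
    "('v :: real_inner \<Rightarrow> real) \<Rightarrow> real \<Rightarrow> ('v \<Rightarrow> ereal) \<Rightarrow> 'v \<Rightarrow> ereal" where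
  "bregman_env \<omega> lam F x = (INF y. F y + ereal ((1 / lam) * bregman \<omega> y x))"

definition bregman_prox ::
    "('v :: real_inner \<Rightarrow> real) \<Rightarrow> real \<Rightarrow> ('v \<Rightarrow> ereal) \<Rightarrow> 'v \<Rightarrow> 'v" where
  "bregman_prox \<omega> lam F x = arg_min (\<lambda>y. F y + ereal ((1 / lam) * bregman \<omega> y x)) (\<lambda>_. True)"

text \<open>The stochastic Bregman distance; \<open>gt x \<xi>\<close> is the given gradient of \<open>\<omega>t \<cdot> \<xi>\<close> at \<open>x\<close>.\<close>

definition sbregman ::
    "('v :: real_inner \<Rightarrow> 'a \<Rightarrow> real) \<Rightarrow> ('v \<Rightarrow> 'a \<Rightarrow> 'v) \<Rightarrow> 'v \<Rightarrow> 'v \<Rightarrow> 'a \<Rightarrow> real" where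
  "sbregman \<omega>t gt x y \<xi> = \<omega>t x \<xi> - \<omega>t y \<xi> - gt y \<xi> \<bullet> (x - y)"

text \<open>A minibatch of size \<open>m\<close> is given by its samples \<open>B 0, \<dots>, B (m - 1)\<close>.\<close>

definition sbregman_batch ::
    "('v :: real_inner \<Rightarrow> 'a \<Rightarrow> real) \<Rightarrow> ('v \<Rightarrow> 'a \<Rightarrow> 'v) \<Rightarrow> nat \<Rightarrow> 'v \<Rightarrow> 'v \<Rightarrow> (nat \<Rightarrow> 'a) \<Rightarrow> real" where
  "sbregman_batch \<omega>t gt m x y B = (1 / real m) * (\<Sum>i<m. sbregman \<omega>t gt x y (B i))"

section \<open>Standing assumptions\<close>

text \<open>\<open>fs x \<xi>\<close> is the sample function \<open>f(x;\<xi>)\<close> and \<open>fm x y \<xi>\<close> is the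
  model \<open>f\<^sub>x(y;\<xi>)\<close>.\<close>

definition exp_fun :: "'a measure \<Rightarrow> ('v \<Rightarrow> 'a \<Rightarrow> real) \<Rightarrow> 'v \<Rightarrow> real" where
  "exp_fun P fs x = (LINT \<xi>|P. fs x \<xi>)"

definition total_obj :: "'a measure \<Rightarrow> ('v \<Rightarrow> 'a \<Rightarrow> real) \<Rightarrow> ('v \<Rightarrow> ereal) \<Rightarrow> 'v \<Rightarrow> ereal" where
  "total_obj P fs r x = ereal (exp_fun P fs x) + r x"

definition model_obj :: "('v \<Rightarrow> 'v \<Rightarrow> 'a \<Rightarrow> real) \<Rightarrow> ('v \<Rightarrow> ereal) \<Rightarrow> 'v \<Rightarrow> 'a \<Rightarrow> 'v \<Rightarrow> ereal" where
  "model_obj fm r x \<xi> y = ereal (fm x y \<xi>) + r y"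

definition setting ::
    "'a measure \<Rightarrow> (real ^ 'd \<Rightarrow> 'a \<Rightarrow> real) \<Rightarrow> (real ^ 'd \<Rightarrow> real ^ 'd \<Rightarrow> 'a \<Rightarrow> real) \<Rightarrow>
     (real ^ 'd \<Rightarrow> ereal) \<Rightarrow> (real ^ 'd \<Rightarrow> real) \<Rightarrow> bool" where
  "setting P fs fm r \<omega> \<longleftrightarrow>
     prob_space P \<and>
     (\<forall>x. integrable P (fs x)) \<and>
     - \<infinity> < (INF x. total_obj P fs r x) \<and>
     proper_fun r \<and> lsc_fun r \<and>
     (\<lambda>(x, y, \<xi>). fm x y \<xi>) \<in> borel_measurable (borel \<Otimes>\<^sub>M borel \<Otimes>\<^sub>M P) \<and>
     (\<forall>x. AE \<xi> in P. proper_fun (model_obj fm r x \<xi>) \<and> lsc_fun (model_obj fm r x \<xi>)) \<and>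
     (\<forall>x. \<omega> differentiable (at x))"

definition dgf_condition ::
    "'a measure \<Rightarrow> (real ^ 'd \<Rightarrow> real) \<Rightarrow> (real ^ 'd \<Rightarrow> 'a \<Rightarrow> real) \<Rightarrow>
     (real ^ 'd \<Rightarrow> 'a \<Rightarrow> real ^ 'd) \<Rightarrow> bool" where
  "dgf_condition P \<omega> \<omega>t gt \<longleftrightarrow>
     (\<lambda>(x, \<xi>). \<omega>t x \<xi>) \<in> borel_measurable (borel \<Otimes>\<^sub>M P) \<and>
     (\<lambda>(x, \<xi>). gt x \<xi>) \<in> borel_measurable (borel \<Otimes>\<^sub>M P) \<and>
     (AE \<xi> in P. (\<forall>x. GDERIV (\<lambda>z. \<omega>t z \<xi>) x :> gt x \<xi>) \<and>
                 one_strongly_convex (\<lambda>z. \<omega>t z \<xi>)) \<and>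
     (\<forall>x. integrable P (\<omega>t x) \<and> integrable P (gt x) \<and>
          (LINT \<xi>|P. \<omega>t x \<xi>) = \<omega> x \<and> (LINT \<xi>|P. gt x \<xi>) = grad \<omega> x)"

definition model_condition ::
    "'a measure \<Rightarrow> (real ^ 'd \<Rightarrow> 'a \<Rightarrow> real) \<Rightarrow> (real ^ 'd \<Rightarrow> real ^ 'd \<Rightarrow> 'a \<Rightarrow> real) \<Rightarrow>
     (real ^ 'd \<Rightarrow> real) \<Rightarrow> real \<Rightarrow> bool" where
  "model_condition P fs fm \<omega> \<tau> \<longleftrightarrow>
     (\<forall>x y. integrable P (fm x y) \<and>
        (LINT \<xi>|P. fm x x \<xi>) = exp_fun P fs x \<and>
        (LINT \<xi>|P. fm x y \<xi> - exp_fun P fs y) \<le> \<tau> * min (bregman \<omega> x y) (bregman \<omega> y x))"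

definition basic_conditions ::
    "'a measure \<Rightarrow> (real ^ 'd \<Rightarrow> 'a \<Rightarrow> real) \<Rightarrow> (real ^ 'd \<Rightarrow> real ^ 'd \<Rightarrow> 'a \<Rightarrow> real) \<Rightarrow>
     (real ^ 'd \<Rightarrow> ereal) \<Rightarrow> (real ^ 'd \<Rightarrow> real) \<Rightarrow> (real ^ 'd \<Rightarrow> 'a \<Rightarrow> real) \<Rightarrow>
     (real ^ 'd \<Rightarrow> 'a \<Rightarrow> real ^ 'd) \<Rightarrow> real \<Rightarrow> real \<Rightarrow> bool" where
  "basic_conditions P fs fm r \<omega> \<omega>t gt \<rho> \<tau> \<longleftrightarrow>
     0 < \<rho> \<and> 0 < \<tau> \<and>
     dgf_condition P \<omega> \<omega>t gt \<and>
     model_condition P fs fm \<omega> \<tau> \<and>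
     (\<forall>x. AE \<xi> in P. rel_weakly_convex \<rho> (\<lambda>z. \<omega>t z \<xi>) (model_obj fm r x \<xi>))"

text \<open>The base point \<open>x\<close> is restricted to the domain of \<open>r\<close>, where the difference is well
  defined (for \<open>y\<close> outside the domain it is \<open>- \<infinity>\<close>): required at all \<open>x\<close>, the inequality
  would force \<open>r\<close> to be finite everywhere.\<close>

definition composite_lipschitz ::
    "'a measure \<Rightarrow> (real ^ 'd \<Rightarrow> real ^ 'd \<Rightarrow> 'a \<Rightarrow> real) \<Rightarrow> (real ^ 'd \<Rightarrow> ereal) \<Rightarrow>
     (real ^ 'd \<Rightarrow> 'a \<Rightarrow> real) \<Rightarrow> (real ^ 'd \<Rightarrow> 'a \<Rightarrow> real ^ 'd) \<Rightarrow> real \<Rightarrow> bool" where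
  "composite_lipschitz P fm r \<omega>t gt L \<longleftrightarrow> 0 < L \<and>
     (\<exists>Lt :: real ^ 'd \<Rightarrow> 'a \<Rightarrow> real.
        (\<lambda>(x, \<xi>). Lt x \<xi>) \<in> borel_measurable (borel \<Otimes>\<^sub>M P) \<and>
        (\<forall>x \<xi>. 0 \<le> Lt x \<xi>) \<and>
        (\<forall>x. integrable P (\<lambda>\<xi>. (Lt x \<xi>)\<^sup>2) \<and> sqrt (LINT \<xi>|P. (Lt x \<xi>)\<^sup>2) \<le> L) \<and>
        (\<forall>x\<in>edom r. \<forall>y. AE \<xi> in P.
           model_obj fm r x \<xi> x - model_obj fm r x \<xi> y \<le>
             ereal (Lt x \<xi> * sqrt (min (sbregman \<omega>t gt x y \<xi>) (sbregman \<omega>t gt y x \<xi>)))))"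

section \<open>The method\<close>

definition batch_obj ::
    "('v :: real_inner \<Rightarrow> 'v \<Rightarrow> 'a \<Rightarrow> real) \<Rightarrow> ('v \<Rightarrow> ereal) \<Rightarrow> ('v \<Rightarrow> 'a \<Rightarrow> real) \<Rightarrow>
     ('v \<Rightarrow> 'a \<Rightarrow> 'v) \<Rightarrow> real \<Rightarrow> nat \<Rightarrow> 'v \<Rightarrow> (nat \<Rightarrow> 'a) \<Rightarrow> 'v \<Rightarrow> ereal" where
  "batch_obj fm r \<omega>t gt t m x B y =
     ereal (1 / real m) *
       (\<Sum>i<m. ereal (fm x y (B i)) + r y + ereal ((1 / t) * sbregman \<omega>t gt y x (B i)))"

text \<open>\<open>\<xi> k i\<close> is the \<open>i\<close>-th sample of the \<open>k\<close>-th minibatch (of size \<open>ms k\<close>), a random variable on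
  the probability space \<open>M\<close> carrying the run. \<open>sample_index ms k\<close> indexes the samples of the
  minibatches \<open>0, \<dots>, k - 1\<close>, and \<open>past P M ms \<xi> k\<close> is the sigma-algebra that they generate.\<close>

definition sample_index :: "(nat \<Rightarrow> nat) \<Rightarrow> nat \<Rightarrow> (nat \<times> nat) set" where
  "sample_index ms k = (SIGMA j:{..<k}. {..<ms j})"

definition samples ::
    "(nat \<Rightarrow> nat) \<Rightarrow> (nat \<Rightarrow> nat \<Rightarrow> 'w \<Rightarrow> 'a) \<Rightarrow> nat \<Rightarrow> 'w \<Rightarrow> nat \<times> nat \<Rightarrow> 'a" where
  "samples ms \<xi> k w = (\<lambda>(j, i)\<in>sample_index ms k. \<xi> j i w)"

definition past ::
    "'a measure \<Rightarrow> 'w measure \<Rightarrow> (nat \<Rightarrow> nat) \<Rightarrow> (nat \<Rightarrow> nat \<Rightarrow> 'w \<Rightarrow> 'a) \<Rightarrow> nat \<Rightarrow> 'w measure" where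
  "past P M ms \<xi> k =
     vimage_algebra (space M) (samples ms \<xi> k) (Pi\<^sub>M (sample_index ms k) (\<lambda>_. P))"

text \<open>A run of \<open>K\<close> iterations from \<open>x0\<close> with step sizes \<open>ts\<close>, batch sizes \<open>ms\<close>, iterates \<open>X k\<close>
  and random output index \<open>kbar\<close>. Since the subproblems are well behaved only for almost
  every sample, the minimization holds almost surely; that an iterate depends only on the
  samples drawn so far is then the measurability with respect to \<open>past\<close>.\<close>

definition method_run ::
    "'a measure \<Rightarrow> (real ^ 'd \<Rightarrow> real ^ 'd \<Rightarrow> 'a \<Rightarrow> real) \<Rightarrow> (real ^ 'd \<Rightarrow> ereal) \<Rightarrow>
     (real ^ 'd \<Rightarrow> 'a \<Rightarrow> real) \<Rightarrow> (real ^ 'd \<Rightarrow> 'a \<Rightarrow> real ^ 'd) \<Rightarrow>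
     (nat \<Rightarrow> real) \<Rightarrow> (nat \<Rightarrow> nat) \<Rightarrow> nat \<Rightarrow> real ^ 'd \<Rightarrow>
     'w measure \<Rightarrow> (nat \<Rightarrow> nat \<Rightarrow> 'w \<Rightarrow> 'a) \<Rightarrow> (nat \<Rightarrow> 'w \<Rightarrow> real ^ 'd) \<Rightarrow> ('w \<Rightarrow> nat) \<Rightarrow> bool" where
  "method_run P fm r \<omega>t gt ts ms K x0 M \<xi> X kbar \<longleftrightarrow>
     prob_space M \<and>
     (\<forall>k<K. 0 < ts k \<and> 0 < ms k) \<and>
     prob_space.indep_vars M (\<lambda>_. P) (\<lambda>(j, i). \<xi> j i) (sample_index ms K) \<and>
     (\<forall>k<K. \<forall>i<ms k. distr M P (\<xi> k i) = P) \<and>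
     (\<forall>w\<in>space M. X 0 w = x0) \<and>
     (\<forall>k<K. X (Suc k) \<in> borel_measurable (past P M ms \<xi> (Suc k))) \<and>
     (\<forall>k<K. AE w in M.
        is_arg_min (batch_obj fm r \<omega>t gt (ts k) (ms k) (X k w) (\<lambda>i. \<xi> k i w)) (\<lambda>_. True)
          (X (Suc k) w)) \<and>
     kbar \<in> measurable M (count_space {..<K}) \<and>
     prob_space.indep_set M
       (sets (vimage_algebra (space M) kbar (count_space {..<K}))) (sets (past P M ms \<xi> K)) \<and>
     (\<forall>k<K. measure M {w \<in> space M. kbar w = k} = ts k / (\<Sum>i<K. ts i))"

text \<open>Bregman distances are nonnegative (the stochastic ones almost surely), so the
  conditional expectations are taken in \<^typ>\<open>ennreal\<close>, without integrability assumptions.\<close>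

definition bregman_lower_bound ::
    "'a measure \<Rightarrow> (real ^ 'd \<Rightarrow> ereal) \<Rightarrow> (real ^ 'd \<Rightarrow> real) \<Rightarrow>
     (real ^ 'd \<Rightarrow> 'a \<Rightarrow> real) \<Rightarrow> (real ^ 'd \<Rightarrow> 'a \<Rightarrow> real ^ 'd) \<Rightarrow> real \<Rightarrow> (nat \<Rightarrow> real) \<Rightarrow>
     (nat \<Rightarrow> nat) \<Rightarrow> nat \<Rightarrow>
     'w measure \<Rightarrow> (nat \<Rightarrow> nat \<Rightarrow> 'w \<Rightarrow> 'a) \<Rightarrow> (nat \<Rightarrow> 'w \<Rightarrow> real ^ 'd) \<Rightarrow> bool" where
  "bregman_lower_bound P F \<omega> \<omega>t gt lam c ms K M \<xi> X \<longleftrightarrow>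
     (\<forall>m. 0 < c m \<and> c m \<le> 1) \<and> c \<longlonglongrightarrow> 1 \<and>
     (\<forall>k<K. AE w in M.
        ennreal (c (ms k)) *
          nn_cond_exp M (past P M ms \<xi> k)
            (\<lambda>w. ennreal (bregman \<omega> (bregman_prox \<omega> lam F (X k w)) (X (Suc k) w))) w
        \<le> nn_cond_exp M (past P M ms \<xi> k)
            (\<lambda>w. ennreal (sbregman_batch \<omega>t gt (ms k) (bregman_prox \<omega> lam F (X k w)) (X (Suc k) w)
                            (\<lambda>i. \<xi> k i w))) w)"

end

theory Submission
  imports Defs
begin

text \<open>Since \<open>F + (\<rho> + \<tau>) \<omega>\<close> is convex, the proximal subproblem is \<open>(1/\<lambda> - \<rho> - \<tau>)\<close>-strongly convex relative to
  \<open>\<omega>\<close>, and each stochastic subproblem is \<open>(1/t - \<rho>)\<close>-strongly convex relative to the sampled distance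
  generating function. Comparing \<open>x\<^sup>k\<^sup>+\<^sup>1\<close> with the proximal point \<open>u\<close> of \<open>x\<^sup>k\<close> in the stochastic
  subproblem, and estimating the model at \<open>x\<^sup>k\<^sup>+\<^sup>1\<close> from below by the Lipschitz condition and Young's
  inequality, gives
  \<open>(1/t - \<rho>) c(m) E D(u, x\<^sup>k\<^sup>+\<^sup>1) \<le> E [F(u) - F(x\<^sup>k) + (\<tau> + 1/t) D(u, x\<^sup>k)] + t L\<^sup>2 / 4\<close>.
  As the envelope at \<open>x\<^sup>k\<^sup>+\<^sup>1\<close> is at most \<open>F(u) + D(u, x\<^sup>k\<^sup>+\<^sup>1) / \<lambda>\<close>, and \<open>F(x\<^sup>k)\<close> is bounded below by the
  three-point inequality for \<open>u\<close>, the expected envelope drops in each step by \<open>\<Gamma>\<close> times the expected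
  symmetrized distance, up to a constant; these inequalities are summed over \<open>k\<close>.\<close>

text \<open>Two obstacles shape the proof. The hypotheses hold for almost every sample, with
  exceptional sets depending on the base point, whereas the base points \<open>X k\<close> are
  random; so the estimates are first proved for a fixed base point. Moreover, no iterate, envelope
  value or distance is assumed integrable along the run. The descent is therefore carried out in
  \<open>ennreal\<close>, for quantities shown to be nonnegative and without subtraction;
  integrability comes out only at the end.

  The constant \<Gamma> arises as follows. Let \<open>A\<close> and \<open>B\<close> be the
  distances of \<open>prox x\<close> from \<open>x\<close> and of \<open>x\<close> from
  \<open>prox x\<close>, and multiply the one-step inequality by \<kappa>, so that its left side
  becomes the expected distance in the new envelope divided by \<open>lam\<close>. On the right,
  \<open>A\<close> then has coefficient \<open>1 / (lam * c m) - \<kappa> * \<beta>\<close> and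
  \<open>B\<close> has \<open>- \<kappa> * \<beta>\<close>. The old envelope pays only for
  \<open>A / lam\<close>; the excess \<open>(1 - c m) / (c m * lam)\<close>, caused by
  \<open>c m < 1\<close>, is charged to the symmetrized distance. What remains of
  \<open>\<kappa> * \<beta>\<close> is \<Gamma> divided by the square of \<open>lam\<close>.\<close>

section \<open>Convexity and measurability\<close>

text \<open>Division by \<open>a n\<close> turns the hypothesis into one on difference quotients,
  and \<open>n\<close> tends to infinity. A sequence of step lengths, instead of all small ones,
  keeps the condition countable.\<close>

lemma gderiv_limit_ineq:
  fixes h :: "'v::real_inner \<Rightarrow> real"
  assumes der: "GDERIV h y :> p" and a: "a \<longlonglongrightarrow> 0" "\<And>n. 0 < a n"
    and ineq: "\<And>n::nat. 0 \<le> a n * \<Delta> + \<beta> * (h (y + a n *\<^sub>R d) - h y)"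
  shows "0 \<le> \<Delta> + \<beta> * (p \<bullet> d)"
proof -
  have "((\<lambda>s. h (y + s *\<^sub>R d)) has_derivative (\<lambda>s. (s *\<^sub>R d) \<bullet> p)) (at 0)"
  proof (rule has_derivative_compose[where f = "\<lambda>s. y + s *\<^sub>R d"])
    show "((\<lambda>s. y + s *\<^sub>R d) has_derivative (\<lambda>s. s *\<^sub>R d)) (at 0)"
      by (auto intro!: derivative_eq_intros)
    show "(h has_derivative (\<lambda>z. z \<bullet> p)) (at (y + 0 *\<^sub>R d))"
      using der by (simp add: gderiv_def)
  qed
  moreover have "(\<lambda>s. (s *\<^sub>R d) \<bullet> p) = (*) (p \<bullet> d)"
    by (auto simp: inner_commute)
  ultimately have "((\<lambda>s. h (y + s *\<^sub>R d)) has_real_derivative p \<bullet> d) (at 0)"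
    by (simp add: has_field_derivative_def)
  then have lim: "((\<lambda>s. (h (y + s *\<^sub>R d) - h y) / s) \<longlongrightarrow> p \<bullet> d) (at 0)"
    by (simp add: DERIV_def)
  have "filterlim a (at 0) sequentially"
    using a by (simp add: filterlim_at less_imp_neq[symmetric])
  with lim have "(\<lambda>n. (h (y + a n *\<^sub>R d) - h y) / a n) \<longlonglongrightarrow> p \<bullet> d"
    by (rule filterlim_compose)
  then have "(\<lambda>n. \<Delta> + \<beta> * ((h (y + a n *\<^sub>R d) - h y) / a n)) \<longlonglongrightarrow> \<Delta> + \<beta> * (p \<bullet> d)"
    by (intro tendsto_intros)
  moreover have "0 \<le> \<Delta> + \<beta> * ((h (y + a n *\<^sub>R d) - h y) / a n)" for n
  proof -
    have "0 \<le> (a n * \<Delta> + \<beta> * (h (y + a n *\<^sub>R d) - h y)) / a n"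
      using ineq[of n] a(2)[of n] by simp
    then show ?thesis using a(2)[of n] by (simp add: field_simps)
  qed
  ultimately show ?thesis by (intro LIMSEQ_le_const) auto
qed

text \<open>\<open>grad\<close> is a definite description, so uniqueness is needed besides
  existence; the gradient is the Riesz vector of the derivative in the standard basis.\<close>

lemma gderiv_grad:
  fixes h :: "'v::euclidean_space \<Rightarrow> real"
  assumes "h differentiable (at x)"
  shows "GDERIV h x :> grad h x"
proof -
  obtain D where D: "(h has_derivative D) (at x)"
    using assms by (auto simp: differentiable_def)
  interpret D: bounded_linear D using D by (rule has_derivative_bounded_linear)
  have "D z = z \<bullet> (\<Sum>b\<in>Basis. D b *\<^sub>R b)" for z
  proof -
    have "D z = D (\<Sum>b\<in>Basis. (z \<bullet> b) *\<^sub>R b)" by (simp add: euclidean_representation)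
    also have "\<dots> = (\<Sum>b\<in>Basis. (z \<bullet> b) * D b)" by (simp add: D.sum D.scaleR)
    finally show ?thesis by (simp add: inner_sum_right mult.commute)
  qed
  then have "D = (\<lambda>z. z \<bullet> (\<Sum>b\<in>Basis. D b *\<^sub>R b))" by (rule ext)
  then have *: "GDERIV h x :> (\<Sum>b\<in>Basis. D b *\<^sub>R b)"
    using D unfolding gderiv_def by simp
  have "g = (\<Sum>b\<in>Basis. D b *\<^sub>R b)" if "GDERIV h x :> g" for g
  proof -
    have "(\<lambda>z. z \<bullet> g) = (\<lambda>z. z \<bullet> (\<Sum>b\<in>Basis. D b *\<^sub>R b))"
      using that * unfolding gderiv_def by (rule has_derivative_unique)
    then show ?thesis unfolding fun_eq_iff by (simp only: vector_eq_ldot)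
  qed
  with * show ?thesis unfolding grad_def by (rule theI)
qed

text \<open>The convex function left after subtracting half the squared norm lies above its
  tangents; the squared norms then recombine into that of \<open>y - x\<close>.\<close>

lemma strongly_convex_above_tangent:
  fixes h :: "'v::real_inner \<Rightarrow> real"
  assumes "one_strongly_convex h" "GDERIV h x :> g"
  shows "h x + g \<bullet> (y - x) + (norm (y - x))\<^sup>2 / 2 \<le> h y"
proof -
  define q where "q = (\<lambda>z. h z - (norm z)\<^sup>2 / 2)"
  have conv: "convex_on UNIV q" using assms(1) by (simp add: one_strongly_convex_def q_def)
  have "GDERIV q x :> g - x"
    using assms(2) unfolding gderiv_def q_def power2_norm_eq_inner
    by (auto intro!: derivative_eq_intros simp: inner_diff_right inner_commute)
  moreover have "(\<lambda>n. 1 / real (n + 2)) \<longlonglongrightarrow> 0" by real_asymp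
  moreover have "0 \<le> 1 / real (n + 2) * (q y - q x) + (-1) * (q (x + (1 / real (n + 2)) *\<^sub>R (y - x)) - q x)" for n
  proof -
    define s where "s = 1 / real (n + 2)"
    have s: "0 \<le> s" "s \<le> 1" by (auto simp: s_def)
    have "q ((1 - s) *\<^sub>R x + s *\<^sub>R y) \<le> (1 - s) * q x + s * q y"
      by (rule convex_onD[OF conv]) (use s in auto)
    moreover have "(1 - s) *\<^sub>R x + s *\<^sub>R y = x + s *\<^sub>R (y - x)" by (simp add: algebra_simps)
    ultimately show ?thesis unfolding s_def[symmetric] by (simp add: algebra_simps)
  qed
  ultimately have "0 \<le> q y - q x + (-1) * ((g - x) \<bullet> (y - x))"
    by (intro gderiv_limit_ineq[where h = q and a = "\<lambda>n. 1 / real (n + 2)"]) auto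
  then show ?thesis
    by (simp add: q_def power2_norm_eq_inner inner_diff_left inner_diff_right inner_commute algebra_simps)
       (simp add: field_simps)
qed

text \<open>First-order optimality at \<open>p\<close> in the direction of \<open>z\<close>: the
  part \<open>G\<close>, which may be nonsmooth, is bounded by its chord and the smooth part
  \<open>h\<close> by its derivative. Replacing this derivative by the true increment of
  \<open>h\<close> produces the Bregman term.\<close>

lemma convex_three_point:
  fixes G h :: "'v::real_inner \<Rightarrow> real"
  assumes conv: "convex_on S G" and der: "GDERIV h p :> g" and S: "p \<in> S" "z \<in> S"
    and a: "a \<longlonglongrightarrow> 0" "\<And>n. 0 < a n" "\<And>n. a n \<le> 1"
    and min: "\<And>n::nat. G p + \<beta> * h p + l \<bullet> p
      \<le> G (p + a n *\<^sub>R (z - p)) + \<beta> * h (p + a n *\<^sub>R (z - p)) + l \<bullet> (p + a n *\<^sub>R (z - p))"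
  shows "G p + \<beta> * h p + l \<bullet> p + \<beta> * (h z - h p - g \<bullet> (z - p)) \<le> G z + \<beta> * h z + l \<bullet> z"
proof -
  have "0 \<le> (G z - G p + l \<bullet> (z - p)) + \<beta> * (g \<bullet> (z - p))"
  proof (rule gderiv_limit_ineq[OF der a(1,2)])
    fix n
    have "p + a n *\<^sub>R (z - p) = (1 - a n) *\<^sub>R p + a n *\<^sub>R z" by (simp add: algebra_simps)
    then have "G (p + a n *\<^sub>R (z - p)) \<le> (1 - a n) * G p + a n * G z"
      using convex_onD[OF conv, of "a n" p z] S a(2,3)[of n] by simp
    then show "0 \<le> a n * (G z - G p + l \<bullet> (z - p)) + \<beta> * (h (p + a n *\<^sub>R (z - p)) - h p)"
      using min[of n] by (simp add: inner_add_right algebra_simps)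
  qed
  then show ?thesis by (simp add: inner_diff_right algebra_simps)
qed

text \<open>When \<open>p\<close> runs through a relative ball inside the simplex,
  \<open>(1 - s) *\<^sub>R y + s *\<^sub>R p\<close> runs through a relatively open set, which a
  dense \<open>Q\<close> must meet. On a simplex a convex function is bounded above by its vertex
  values.\<close>

lemma convex_countable_approximation:
  fixes S :: "'v::euclidean_space set"
  assumes "convex S" "S \<noteq> {}"
  obtains Q V where "countable Q" "Q \<subseteq> S" "finite V" "V \<subseteq> S" "V \<noteq> {}"
    "\<And>y s. y \<in> S \<Longrightarrow> 0 < s \<Longrightarrow> s < 1 \<Longrightarrow> \<exists>p\<in>convex hull V. (1 - s) *\<^sub>R y + s *\<^sub>R p \<in> Q"
proof -
  obtain Q where Q: "countable Q" "Q \<subseteq> S" "S \<subseteq> closure Q"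
    using separable by blast
  obtain V where V: "\<not> affine_dependent V" "V \<subseteq> S" "affine hull S = affine hull V"
    using affine_basis_exists by metis
  have fin: "finite V" using V(1) aff_independent_finite by blast
  have ne: "V \<noteq> {}" using V(3) assms(2) by auto
  have "rel_interior (convex hull V) \<noteq> {}"
    using ne by (simp add: rel_interior_eq_empty)
  then obtain p0 e where p0: "p0 \<in> convex hull V" "0 < e"
    and e: "ball p0 e \<inter> affine hull V \<subseteq> convex hull V"
    by (auto simp: rel_interior_ball affine_hull_convex_hull)
  have "\<exists>p\<in>convex hull V. (1 - s) *\<^sub>R y + s *\<^sub>R p \<in> Q" if y: "y \<in> S" and s: "0 < s" "s < 1" for y s
  proof -
    define q0 where "q0 = (1 - s) *\<^sub>R y + s *\<^sub>R p0"
    have "p0 \<in> S" using p0(1) hull_minimal[of V S convex, OF V(2) assms(1)] by blast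
    then have "q0 \<in> S" unfolding q0_def using y s assms(1) by (intro convexD) auto
    then have "q0 \<in> closure Q" using Q by auto
    then obtain z where z: "z \<in> Q" "dist z q0 < s * e"
      unfolding closure_approachable using s p0(2) by (meson mult_pos_pos)
    \<comment> \<open>Solves \<open>z = (1 - s) *\<^sub>R y + s *\<^sub>R p\<close> for
      \<open>p\<close>; this magnifies distances by \<open>1 / s\<close>, whence the tolerance
      \<open>s * e\<close> for \<open>z\<close>.\<close>
    define p where "p = (1 / s) *\<^sub>R z + (1 - 1 / s) *\<^sub>R y"
    have zp: "z = (1 - s) *\<^sub>R y + s *\<^sub>R p" using s by (simp add: p_def algebra_simps)
    have "z \<in> affine hull V" "y \<in> affine hull V"
      using z(1) Q(2) y V(3) hull_subset[of S affine] by auto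
    then have "p \<in> affine hull V" unfolding p_def
      by (intro mem_affine[OF affine_affine_hull]) auto
    moreover have "dist p p0 < e"
    proof -
      have "z - q0 = s *\<^sub>R (p - p0)" by (subst zp) (simp add: q0_def algebra_simps)
      then have "s * dist p p0 < s * e" using z(2) s by (simp add: dist_norm)
      then show ?thesis using s by simp
    qed
    ultimately have "p \<in> convex hull V" using e by (auto simp: dist_commute)
    then show ?thesis using zp z(1) by metis
  qed
  with Q fin V(2) ne show ?thesis by (intro that) auto
qed

text \<open>Doob-Dynkin factorization: level sets of simple functions are preimages under
  \<open>S\<close>, so simple functions factor, and the factors are passed to the limit.\<close>

lemma borel_measurable_vimage_algebra_factor:
  fixes f :: "'w \<Rightarrow> 'b::{banach, second_countable_topology}"
  assumes S: "S \<in> X \<rightarrow> space N" and f: "f \<in> borel_measurable (vimage_algebra X S N)"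
  obtains g where "g \<in> borel_measurable N" "\<And>x. x \<in> X \<Longrightarrow> f x = g (S x)"
proof -
  obtain F where F: "\<And>i. simple_function (vimage_algebra X S N) (F i)"
    "\<And>x. x \<in> X \<Longrightarrow> (\<lambda>i. F i x) \<longlonglongrightarrow> f x"
    using borel_measurable_implies_sequence_metric[OF f, of 0] by auto
  have "\<exists>g. g \<in> borel_measurable N \<and> (\<forall>x\<in>X. F i x = g (S x))" for i
  proof -
    have "\<exists>A\<in>sets N. F i -` {v} \<inter> X = S -` A \<inter> X" if "v \<in> F i ` X" for v
    proof -
      have "F i -` {v} \<inter> X \<in> sets (vimage_algebra X S N)"
        using F(1)[of i] that unfolding simple_function_def space_vimage_algebra by blast
      then show ?thesis using S by (auto simp: sets_vimage_algebra2)
    qed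
    then obtain A where A: "\<And>v. v \<in> F i ` X \<Longrightarrow> A v \<in> sets N \<and> F i -` {v} \<inter> X = S -` A v \<inter> X"
      by metis
    have fin: "finite (F i ` X)" using F(1)[of i] by (simp add: simple_function_def)
    define g where "g z = (\<Sum>v\<in>F i ` X. indicat_real (A v) z *\<^sub>R v)" for z
    have "g \<in> borel_measurable N" unfolding g_def
      by (intro borel_measurable_sum borel_measurable_scaleR borel_measurable_indicator) (use A in auto)
    moreover have "F i x = g (S x)" if x: "x \<in> X" for x
    proof -
      have "indicat_real (A v) (S x) = (if v = F i x then 1 else 0)" if "v \<in> F i ` X" for v
        using A[OF that] x by (auto simp: indicator_def)
      then have "g (S x) = (\<Sum>v\<in>F i ` X. if v = F i x then v else 0)"
        unfolding g_def by (intro sum.cong) auto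
      then show ?thesis using x fin by simp
    qed
    ultimately show ?thesis by blast
  qed
  then obtain g where g: "\<And>i. g i \<in> borel_measurable N" "\<And>i x. x \<in> X \<Longrightarrow> F i x = g i (S x)"
    by metis
  show ?thesis
  proof
    \<comment> \<open>Off the image of \<open>S\<close> the sequence \<open>g i\<close> may diverge;
      \<open>lim\<close> still gives a measurable function there.\<close>
    show "(\<lambda>z. lim (\<lambda>i. g i z)) \<in> borel_measurable N"
      using g(1) by measurable
    show "f x = lim (\<lambda>i. g i (S x))" if "x \<in> X" for x
      using F(2)[OF that] g(2)[OF that] by (simp add: limI)
  qed
qed

text \<open>Strict superlevel sets are open. The filter \<open>at x\<close> omits \<open>x\<close>,
  whose own value is covered by its membership in the set.\<close>

lemma borel_measurable_lsc:
  fixes \<phi> :: "'v::topological_space \<Rightarrow> ereal"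
  assumes "lsc_fun \<phi>"
  shows "\<phi> \<in> borel_measurable borel"
proof (rule borel_measurableI_greater)
  fix a
  have "\<exists>T. open T \<and> x \<in> T \<and> T \<subseteq> {x. a < \<phi> x}" if "a < \<phi> x" for x
  proof -
    have "a < Liminf (at x) \<phi>" using that assms by (auto simp: lsc_fun_def intro: less_le_trans)
    then have "eventually (\<lambda>z. a < \<phi> z) (at x)" by (rule less_LiminfD)
    then obtain T where "open T" "x \<in> T" "\<forall>z\<in>T. z \<noteq> x \<longrightarrow> a < \<phi> z"
      unfolding eventually_at_topological by blast
    with that show ?thesis by (intro exI[of _ T]) auto
  qed
  then have "open {x. a < \<phi> x}" by (subst open_subopen) auto
  then show "{x \<in> space borel. a < \<phi> x} \<in> sets borel" by simp
qed

text \<open>The free weight \<open>a\<close> serves two purposes: small values give lower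
  semicontinuity, and \<open>a = t / 2\<close> fits the proximal term of a subproblem.\<close>

lemma young_sqrt:
  fixes l s a :: real
  assumes "0 \<le> s" "0 < a"
  shows "l * sqrt s \<le> a / 2 * l\<^sup>2 + s / (2 * a)"
proof -
  have "0 \<le> (a * l - sqrt s)\<^sup>2 / (2 * a)" using assms by simp
  also have "\<dots> = a / 2 * l\<^sup>2 + s / (2 * a) - l * sqrt s"
    using assms by (simp add: power2_diff power_mult_distrib field_simps power2_eq_square)
  finally show ?thesis by simp
qed

lemma gderiv_sum:
  assumes "\<And>i. i \<in> I \<Longrightarrow> GDERIV (f i) x :> g i"
  shows "GDERIV (\<lambda>z. \<Sum>i\<in>I. f i z) x :> (\<Sum>i\<in>I. g i)"
  using assms unfolding gderiv_def inner_sum_right by (intro has_derivative_sum) auto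

lemma gderiv_scale:
  assumes "GDERIV f x :> g"
  shows "GDERIV (\<lambda>z. c * f z) x :> c *\<^sub>R g"
  using assms unfolding gderiv_def inner_scaleR_right by (intro has_derivative_mult_right)

lemma convex_on_sum_fun:
  assumes "finite I" "convex S" "\<And>i. i \<in> I \<Longrightarrow> convex_on S (f i)"
  shows "convex_on S (\<lambda>x. \<Sum>i\<in>I. f i x)"
  using assms by (induction I rule: finite_induct) (auto intro: convex_on_add simp: convex_on_const)

section \<open>Proximal points of the objective\<close>

locale stochastic_model =
  fixes P :: "'a measure"
    and fs :: "real ^ 'd \<Rightarrow> 'a \<Rightarrow> real" and fm :: "real ^ 'd \<Rightarrow> real ^ 'd \<Rightarrow> 'a \<Rightarrow> real"
    and r :: "real ^ 'd \<Rightarrow> ereal" and \<omega> :: "real ^ 'd \<Rightarrow> real"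
    and \<omega>t :: "real ^ 'd \<Rightarrow> 'a \<Rightarrow> real" and gt :: "real ^ 'd \<Rightarrow> 'a \<Rightarrow> real ^ 'd"
    and \<rho> \<tau> L lam :: real
  assumes setting: "setting P fs fm r \<omega>"
    and basic: "basic_conditions P fs fm r \<omega> \<omega>t gt \<rho> \<tau>"
    and lip: "composite_lipschitz P fm r \<omega>t gt L"
    and lam_pos: "0 < lam" and lam_less: "lam < 1 / (\<rho> + \<tau>)"
begin

sublocale prob_space P
  using setting by (simp add: setting_def)

text \<open>Outside \<open>dom r\<close>, \<open>r_real\<close> has the junk value \<open>0\<close>; inequalities for it and for \<open>F_real\<close> are
  stated on \<open>dom r\<close> only.\<close>

definition r_real :: "real ^ 'd \<Rightarrow> real" where "r_real x = real_of_ereal (r x)"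
definition F_real :: "real ^ 'd \<Rightarrow> real" where "F_real x = exp_fun P fs x + r_real x"
abbreviation "F \<equiv> total_obj P fs r"
abbreviation "dom_r \<equiv> edom r"
abbreviation "sD \<equiv> sbregman \<omega>t gt"
abbreviation "Dw \<equiv> bregman \<omega>"

definition regular :: "'a \<Rightarrow> bool" where
  "regular \<xi> \<longleftrightarrow> (\<forall>x. GDERIV (\<lambda>z. \<omega>t z \<xi>) x :> gt x \<xi>) \<and> one_strongly_convex (\<lambda>z. \<omega>t z \<xi>)"

lemma rho_pos: "0 < \<rho>" and tau_pos: "0 < \<tau>"
  using basic by (auto simp: basic_conditions_def)

lemma dgf: "dgf_condition P \<omega> \<omega>t gt" and model: "model_condition P fs fm \<omega> \<tau>"
  using basic by (auto simp: basic_conditions_def)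

lemma AE_regular: "AE \<xi> in P. regular \<xi>"
  using dgf by (simp add: dgf_condition_def regular_def)

lemma integrable_dgf [simp, intro]: "integrable P (\<omega>t x)" "integrable P (gt x)"
  and integral_dgf: "(LINT \<xi>|P. \<omega>t x \<xi>) = \<omega> x" "(LINT \<xi>|P. gt x \<xi>) = grad \<omega> x"
  using dgf by (auto simp: dgf_condition_def)

lemma integrable_model [simp, intro]: "integrable P (fm x y)"
  and integral_model_base: "(LINT \<xi>|P. fm x x \<xi>) = exp_fun P fs x"
  using model by (auto simp: model_condition_def)

lemma integral_model_le: "(LINT \<xi>|P. fm x y \<xi>) \<le> exp_fun P fs y + \<tau> * min (Dw x y) (Dw y x)"
proof -
  have "(LINT \<xi>|P. fm x y \<xi> - exp_fun P fs y) \<le> \<tau> * min (Dw x y) (Dw y x)"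
    using model unfolding model_condition_def by blast
  then show ?thesis by (simp add: Bochner_Integration.integral_diff prob_space)
qed

lemma r_not_minf: "r x \<noteq> - \<infinity>"
  using setting by (auto simp: setting_def proper_fun_def)

lemma dom_r_nonempty: "dom_r \<noteq> {}"
  using setting by (auto simp: setting_def proper_fun_def edom_def)

lemma r_dom: "x \<in> dom_r \<Longrightarrow> r x = ereal (r_real x)"
  using r_not_minf[of x] by (cases "r x") (auto simp: r_real_def edom_def)

lemma r_notin_dom: "x \<notin> dom_r \<Longrightarrow> r x = \<infinity>"
  by (auto simp: edom_def)

lemma F_dom: "x \<in> dom_r \<Longrightarrow> F x = ereal (F_real x)"
  by (simp add: total_obj_def F_real_def r_dom)

lemma F_notin_dom: "x \<notin> dom_r \<Longrightarrow> F x = \<infinity>"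
  by (simp add: total_obj_def r_notin_dom)

lemma sD_ge: "regular \<xi> \<Longrightarrow> (norm (y - x))\<^sup>2 / 2 \<le> sD y x \<xi>"
  using strongly_convex_above_tangent[of "\<lambda>z. \<omega>t z \<xi>" x "gt x \<xi>" y]
  by (simp add: regular_def sbregman_def)

lemma sD_nonneg: "regular \<xi> \<Longrightarrow> 0 \<le> sD y x \<xi>"
  using sD_ge[of \<xi> y x] zero_le_power2[of "norm (y - x)"] by linarith

lemma integrable_sD [simp, intro]: "integrable P (sD y x)"
  and integral_sD: "(LINT \<xi>|P. sD y x \<xi>) = Dw y x"
  using integrable_dgf integral_dgf
  by (auto simp: sbregman_def[abs_def] bregman_def Bochner_Integration.integral_diff)

text \<open>Strong convexity is assumed of the samples; the quadratic bound passes to \<omega> by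
  taking expectations.\<close>

lemma Dw_ge: "(norm (y - x))\<^sup>2 / 2 \<le> Dw y x"
proof -
  have "(LINT \<xi>|P. (norm (y - x))\<^sup>2 / 2) \<le> (LINT \<xi>|P. sD y x \<xi>)"
  proof (rule integral_mono_AE)
    show "AE \<xi> in P. (norm (y - x))\<^sup>2 / 2 \<le> sD y x \<xi>"
      using AE_regular by eventually_elim (rule sD_ge)
  qed auto
  then show ?thesis by (simp add: integral_sD prob_space)
qed

lemma Dw_nonneg: "0 \<le> Dw y x"
  using Dw_ge[of y x] zero_le_power2[of "norm (y - x)"] by linarith

lemma gderiv_omega: "GDERIV \<omega> x :> grad \<omega> x"
  using setting by (intro gderiv_grad) (simp add: setting_def)

lemma continuous_omega: "continuous_on UNIV \<omega>"
  using setting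
  by (auto simp: setting_def continuous_on_eq_continuous_at differentiable_imp_continuous_within)

lemma tendsto_omega: "y \<longlonglongrightarrow> z \<Longrightarrow> (\<lambda>n. \<omega> (y n)) \<longlonglongrightarrow> \<omega> z"
  using continuous_omega continuous_on_tendsto_compose[of UNIV \<omega>] by auto

lemma tendsto_Dw: "y \<longlonglongrightarrow> z \<Longrightarrow> (\<lambda>n. Dw (y n) x) \<longlonglongrightarrow> Dw z x"
  unfolding bregman_def by (intro tendsto_intros tendsto_omega)

lemma regular_continuous: "regular \<xi> \<Longrightarrow> continuous_on UNIV (\<lambda>z. \<omega>t z \<xi>)"
  by (auto simp: regular_def gderiv_def continuous_on_eq_continuous_at intro: has_derivative_continuous)

lemma regular_tendsto: "regular \<xi> \<Longrightarrow> y \<longlonglongrightarrow> z \<Longrightarrow> (\<lambda>n. \<omega>t (y n) \<xi>) \<longlonglongrightarrow> \<omega>t z \<xi>"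
  using regular_continuous continuous_on_tendsto_compose[of UNIV "\<lambda>z. \<omega>t z \<xi>"] by auto

section \<open>Convexity of \<open>edom r\<close> and relative weak convexity of the
  objective\<close>

lemma AE_obtain: "AE \<xi> in P. Q \<xi> \<Longrightarrow> \<exists>\<xi>. Q \<xi>"
  using AE_False by (metis (mono_tags, lifting) eventually_mono)

lemma AE_econvex: "AE \<xi> in P. econvex (\<lambda>y. ereal (fm x y \<xi>) + r y + ereal (\<rho> * \<omega>t y \<xi>))"
  using basic unfolding basic_conditions_def rel_weakly_convex_def model_obj_def by auto

text \<open>For a single good sample, the convex function differs from \<open>r\<close> by real
  values only, so both are finite at the same points.\<close>

lemma convex_dom_r: "convex dom_r"
proof -
  obtain \<xi> where e: "econvex (\<lambda>y. ereal (fm 0 y \<xi>) + r y + ereal (\<rho> * \<omega>t y \<xi>))"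
    using AE_obtain[OF AE_econvex[of 0]] by blast
  show ?thesis
  proof (rule convexI)
    fix x y :: "real ^ 'd" and u v :: real
    assume *: "x \<in> dom_r" "y \<in> dom_r" "0 \<le> u" "0 \<le> v" "u + v = 1"
    let ?z = "u *\<^sub>R x + v *\<^sub>R y"
    have "ereal (fm 0 ?z \<xi>) + r ?z + ereal (\<rho> * \<omega>t ?z \<xi>)
      \<le> ereal u * (ereal (fm 0 x \<xi>) + r x + ereal (\<rho> * \<omega>t x \<xi>))
       + ereal v * (ereal (fm 0 y \<xi>) + r y + ereal (\<rho> * \<omega>t y \<xi>))"
      using e * unfolding econvex_def by blast
    then have "r ?z \<noteq> \<infinity>" using * by (auto simp: r_dom)
    then show "?z \<in> dom_r" by (auto simp: edom_def)
  qed
qed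

lemma AE_convex_on: "AE \<xi> in P. convex_on dom_r (\<lambda>y. fm x y \<xi> + r_real y + \<rho> * \<omega>t y \<xi>)"
  using AE_econvex[of x]
proof eventually_elim
  case (elim \<xi>)
  show ?case unfolding convex_on_def
  proof (intro conjI ballI allI impI)
    fix y z and u v :: real
    assume *: "y \<in> dom_r" "z \<in> dom_r" "0 \<le> u" "0 \<le> v" "u + v = 1"
    let ?z = "u *\<^sub>R y + v *\<^sub>R z"
    have "?z \<in> dom_r" using * convex_dom_r by (auto intro: convexD)
    moreover have "ereal (fm x ?z \<xi>) + r ?z + ereal (\<rho> * \<omega>t ?z \<xi>)
      \<le> ereal u * (ereal (fm x y \<xi>) + r y + ereal (\<rho> * \<omega>t y \<xi>))
       + ereal v * (ereal (fm x z \<xi>) + r z + ereal (\<rho> * \<omega>t z \<xi>))"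
      using elim * unfolding econvex_def by blast
    ultimately show "fm x ?z \<xi> + r_real ?z + \<rho> * \<omega>t ?z \<xi>
      \<le> u * (fm x y \<xi> + r_real y + \<rho> * \<omega>t y \<xi>) + v * (fm x z \<xi> + r_real z + \<rho> * \<omega>t z \<xi>)"
      using * by (simp add: r_dom)
  qed (rule convex_dom_r)
qed

text \<open>The models are based at the convex combination \<open>z\<close> itself: there they agree
  with the objective in expectation, while at the endpoints they exceed it by at most \<tau> times
  the distance from \<open>z\<close>. In the weighted sum of these distances the gradient terms
  cancel, leaving exactly the convexity defect of \<omega>.\<close>

lemma convex_on_F_real: "convex_on dom_r (\<lambda>y. F_real y + (\<rho> + \<tau>) * \<omega> y)"
  unfolding convex_on_def
proof (intro conjI ballI allI impI)
  fix x y and u v :: real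
  assume *: "x \<in> dom_r" "y \<in> dom_r" "0 \<le> u" "0 \<le> v" "u + v = 1"
  define z where "z = u *\<^sub>R x + v *\<^sub>R y"
  have ilin: "integrable P (\<lambda>\<xi>. fm z q \<xi> + r_real q + \<rho> * \<omega>t q \<xi>)" for q
    by (intro Bochner_Integration.integrable_add integrable_mult_right) auto
  have elin: "(LINT \<xi>|P. fm z q \<xi> + r_real q + \<rho> * \<omega>t q \<xi>) = (LINT \<xi>|P. fm z q \<xi>) + r_real q + \<rho> * \<omega> q" for q
    by (simp add: integrable_model integrable_dgf integral_dgf prob_space)
  have "(LINT \<xi>|P. fm z z \<xi> + r_real z + \<rho> * \<omega>t z \<xi>) \<le>
    (LINT \<xi>|P. u * (fm z x \<xi> + r_real x + \<rho> * \<omega>t x \<xi>) + v * (fm z y \<xi> + r_real y + \<rho> * \<omega>t y \<xi>))"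
  proof (rule integral_mono_AE)
    show "AE \<xi> in P. fm z z \<xi> + r_real z + \<rho> * \<omega>t z \<xi> \<le>
      u * (fm z x \<xi> + r_real x + \<rho> * \<omega>t x \<xi>) + v * (fm z y \<xi> + r_real y + \<rho> * \<omega>t y \<xi>)"
      using AE_convex_on[of z]
      by eventually_elim (use * in \<open>auto simp: convex_on_def z_def\<close>)
  qed (intro ilin Bochner_Integration.integrable_add integrable_mult_right)+
  also have "\<dots> = u * ((LINT \<xi>|P. fm z x \<xi>) + r_real x + \<rho> * \<omega> x) + v * ((LINT \<xi>|P. fm z y \<xi>) + r_real y + \<rho> * \<omega> y)"
    by (subst Bochner_Integration.integral_add) (auto intro!: integrable_mult_right ilin simp: elin)
  also have "\<dots> \<le> u * (exp_fun P fs x + \<tau> * Dw x z + r_real x + \<rho> * \<omega> x)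
      + v * (exp_fun P fs y + \<tau> * Dw y z + r_real y + \<rho> * \<omega> y)"
  proof -
    have "(LINT \<xi>|P. fm z q \<xi>) \<le> exp_fun P fs q + \<tau> * Dw q z" for q
      using integral_model_le[of z q] tau_pos
      by (auto intro: order_trans[OF _ add_left_mono[OF mult_left_mono]])
    then show ?thesis using * by (intro add_mono mult_left_mono order_refl) auto
  qed
  finally have "F_real z + \<rho> * \<omega> z \<le> u * (F_real x + \<rho> * \<omega> x) + v * (F_real y + \<rho> * \<omega> y)
      + \<tau> * (u * Dw x z + v * Dw y z)"
    unfolding elin integral_model_base F_real_def by (simp add: algebra_simps)
  also have "u * Dw x z + v * Dw y z = u * \<omega> x + v * \<omega> y - (u + v) * \<omega> z - grad \<omega> z \<bullet> (u *\<^sub>R (x - z) + v *\<^sub>R (y - z))"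
    by (simp add: bregman_def inner_add_right algebra_simps)
  also have "u *\<^sub>R (x - z) + v *\<^sub>R (y - z) = z - (u + v) *\<^sub>R z"
    by (simp add: z_def algebra_simps)
  finally show "F_real (u *\<^sub>R x + v *\<^sub>R y) + (\<rho> + \<tau>) * \<omega> (u *\<^sub>R x + v *\<^sub>R y)
      \<le> u * (F_real x + (\<rho> + \<tau>) * \<omega> x) + v * (F_real y + (\<rho> + \<tau>) * \<omega> y)"
    using *(5) unfolding z_def[symmetric] by (simp add: algebra_simps)
qed (rule convex_dom_r)

section \<open>Lipschitz estimates and lower semicontinuity of the objective\<close>

definition is_lip :: "(real ^ 'd \<Rightarrow> 'a \<Rightarrow> real) \<Rightarrow> bool" where
  "is_lip l \<longleftrightarrow>
     (\<forall>x. integrable P (\<lambda>\<xi>. (l x \<xi>)\<^sup>2) \<and> (LINT \<xi>|P. (l x \<xi>)\<^sup>2) \<le> L\<^sup>2) \<and>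
     (\<forall>x\<in>dom_r. \<forall>y\<in>dom_r. AE \<xi> in P.
        fm x x \<xi> + r_real x \<le> fm x y \<xi> + r_real y + l x \<xi> * sqrt (sD y x \<xi>))"

definition Lt :: "real ^ 'd \<Rightarrow> 'a \<Rightarrow> real" where "Lt = (SOME l. is_lip l)"

text \<open>Of the minimum in the hypothesis, the distance kept is the one with gradient at the base
  point \<open>x\<close>, which also occurs in the subproblem.\<close>

lemma is_lip_Lt: "is_lip Lt"
proof -
  obtain l where l: "\<And>x \<xi>. 0 \<le> l x \<xi>"
    "\<And>x. integrable P (\<lambda>\<xi>. (l x \<xi>)\<^sup>2)" "\<And>x. sqrt (LINT \<xi>|P. (l x \<xi>)\<^sup>2) \<le> L"
    and lip: "\<And>x y. x \<in> dom_r \<Longrightarrow> AE \<xi> in P. model_obj fm r x \<xi> x - model_obj fm r x \<xi> y \<le>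
             ereal (l x \<xi> * sqrt (min (sD x y \<xi>) (sD y x \<xi>)))"
    using lip unfolding composite_lipschitz_def by blast
  have "(LINT \<xi>|P. (l x \<xi>)\<^sup>2) \<le> L\<^sup>2" for x
    using l(3)[of x] by (rule sqrt_le_D)
  moreover have "AE \<xi> in P. fm x x \<xi> + r_real x \<le> fm x y \<xi> + r_real y + l x \<xi> * sqrt (sD y x \<xi>)"
    if xy: "x \<in> dom_r" "y \<in> dom_r" for x y
    using lip[OF xy(1), of y]
  proof eventually_elim
    case (elim \<xi>)
    then have "fm x x \<xi> + r_real x - (fm x y \<xi> + r_real y) \<le> l x \<xi> * sqrt (min (sD x y \<xi>) (sD y x \<xi>))"
      using xy by (simp add: model_obj_def r_dom)
    also have "\<dots> \<le> l x \<xi> * sqrt (sD y x \<xi>)" using l(1) by (intro mult_left_mono) auto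
    finally show ?case by simp
  qed
  ultimately have "is_lip l" using l(2) unfolding is_lip_def by blast
  then show ?thesis unfolding Lt_def by (rule someI[of is_lip l])
qed

lemma integrable_Lt [simp, intro]: "integrable P (\<lambda>\<xi>. (Lt x \<xi>)\<^sup>2)"
  and integral_Lt: "(LINT \<xi>|P. (Lt x \<xi>)\<^sup>2) \<le> L\<^sup>2"
  and AE_lip: "x \<in> dom_r \<Longrightarrow> y \<in> dom_r \<Longrightarrow>
    AE \<xi> in P. fm x x \<xi> + r_real x \<le> fm x y \<xi> + r_real y + Lt x \<xi> * sqrt (sD y x \<xi>)"
  using is_lip_Lt unfolding is_lip_def by auto

text \<open>The minimizer of a subproblem depends on \<open>\<xi>\<close>, so the exceptional null set of the Lipschitz
  condition must not depend on \<open>y\<close>. A countable dense set does not suffice directly, since convex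
  functions may jump at the relative boundary; points close to \<open>y\<close> on its segments to a simplex
  spanning the affine hull of \<open>dom r\<close> are used instead.\<close>

lemma AE_lip_all:
  assumes x: "x \<in> dom_r"
  shows "AE \<xi> in P. \<forall>y\<in>dom_r. fm x x \<xi> + r_real x \<le> fm x y \<xi> + r_real y + Lt x \<xi> * sqrt (sD y x \<xi>)"
proof -
  obtain Q V where Q: "countable Q" "Q \<subseteq> dom_r" and V: "finite V" "V \<subseteq> dom_r" "V \<noteq> {}"
    and approx: "\<And>y s. y \<in> dom_r \<Longrightarrow> 0 < s \<Longrightarrow> s < 1 \<Longrightarrow>
      \<exists>p\<in>convex hull V. (1 - s) *\<^sub>R y + s *\<^sub>R p \<in> Q"
    using convex_countable_approximation[OF convex_dom_r dom_r_nonempty] by metis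
  have "AE \<xi> in P. \<forall>q\<in>Q. fm x x \<xi> + r_real x \<le> fm x q \<xi> + r_real q + Lt x \<xi> * sqrt (sD q x \<xi>)"
    using AE_lip[OF x] Q by (intro AE_ball_countable') auto
  then show ?thesis using AE_convex_on[of x] AE_regular
  proof eventually_elim
    case (elim \<xi>)
    define H where "H = (\<lambda>y. fm x y \<xi> + r_real y + \<rho> * \<omega>t y \<xi>)"
    have H: "convex_on dom_r H" using elim(2) by (simp add: H_def)
    have hull: "convex hull V \<subseteq> dom_r" using V(2) convex_dom_r by (rule hull_minimal)
    define b where "b = Max (H ` V)"
    have "convex_on (convex hull V) H" using H hull by (rule convex_on_subset) simp
    then have Hb: "H p \<le> b" if "p \<in> convex hull V" for p
      using convex_on_convex_hull_bound[of V H b] that V by (auto simp: b_def)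
    have bdd: "bounded (convex hull V)" using V(1) by (simp add: finite_imp_bounded bounded_convex_hull)
    show ?case
    proof
      fix y assume y: "y \<in> dom_r"
      define s where "s n = 1 / real (n + 2)" for n
      have s: "0 < s n" "s n < 1" for n by (auto simp: s_def)
      have s0: "s \<longlonglongrightarrow> 0" unfolding s_def by real_asymp
      obtain p where p: "\<And>n. p n \<in> convex hull V" "\<And>n. (1 - s n) *\<^sub>R y + s n *\<^sub>R p n \<in> Q"
        using approx[OF y s] by metis
      define q where "q n = (1 - s n) *\<^sub>R y + s n *\<^sub>R p n" for n
      obtain B where "\<And>z. z \<in> convex hull V \<Longrightarrow> norm z \<le> B" using bdd by (auto simp: bounded_iff)
      then have "(\<lambda>n. s n *\<^sub>R p n) \<longlonglongrightarrow> 0"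
        using p(1) by (intro lim_null_scaleR_bounded[OF s0, of p B]) auto
      then have qy: "q \<longlonglongrightarrow> y"
        unfolding q_def
        using tendsto_add[OF tendsto_scaleR[OF tendsto_diff[OF tendsto_const[of 1] s0] tendsto_const[of y]], of _ 0]
        by simp
      \<comment> \<open>\<open>H (q n)\<close> need not converge to \<open>H y\<close>, but the
        inequality at \<open>q n\<close> requires only an upper bound, and the chord bound does tend
        to \<open>H y\<close>.\<close>
      have "fm x x \<xi> + r_real x \<le> (1 - s n) * H y + s n * b - \<rho> * \<omega>t (q n) \<xi> + Lt x \<xi> * sqrt (sD (q n) x \<xi>)" for n
      proof -
        have "H (q n) \<le> (1 - s n) * H y + s n * H (p n)"
          unfolding q_def using s[of n] y p(1)[of n] hull by (intro convex_onD[OF H]) auto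
        also have "\<dots> \<le> (1 - s n) * H y + s n * b"
          using Hb[OF p(1)] s[of n] by simp
        finally show ?thesis using elim(1) p(2)[of n] by (auto simp: q_def H_def)
      qed
      moreover have "(\<lambda>n. (1 - s n) * H y + s n * b - \<rho> * \<omega>t (q n) \<xi> + Lt x \<xi> * sqrt (sD (q n) x \<xi>))
        \<longlonglongrightarrow> (1 - 0) * H y + 0 * b - \<rho> * \<omega>t y \<xi> + Lt x \<xi> * sqrt (sD y x \<xi>)"
        unfolding sbregman_def by (intro tendsto_intros s0 regular_tendsto[OF elim(3)] qy)
      ultimately have "fm x x \<xi> + r_real x \<le> (1 - 0) * H y + 0 * b - \<rho> * \<omega>t y \<xi> + Lt x \<xi> * sqrt (sD y x \<xi>)"
        by (intro LIMSEQ_le_const) auto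
      then show "fm x x \<xi> + r_real x \<le> fm x y \<xi> + r_real y + Lt x \<xi> * sqrt (sD y x \<xi>)"
        by (simp add: H_def)
    qed
  qed
qed

lemma AE_lip_young:
  assumes "x \<in> dom_r" "y \<in> dom_r" "0 < a"
  shows "AE \<xi> in P. fm x x \<xi> + r_real x \<le> fm x y \<xi> + r_real y + a / 2 * (Lt x \<xi>)\<^sup>2 + sD y x \<xi> / (2 * a)"
  using AE_lip[OF assms(1,2)] AE_regular
proof eventually_elim
  case (elim \<xi>)
  then show ?case using young_sqrt[OF sD_nonneg assms(3), of \<xi> "Lt x \<xi>" y x] by linarith
qed

text \<open>As \<open>y\<close> tends to \<open>x\<close> both distance terms vanish and
  \<open>a / 2 * L\<^sup>2\<close> remains, with \<open>a\<close> arbitrarily small: this yields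
  lower semicontinuity on \<open>edom r\<close>.\<close>

lemma F_real_lip:
  assumes "x \<in> dom_r" "y \<in> dom_r" "0 < a"
  shows "F_real x \<le> F_real y + \<tau> * Dw y x + a / 2 * L\<^sup>2 + Dw y x / (2 * a)"
proof -
  have "(LINT \<xi>|P. fm x x \<xi> + r_real x)
    \<le> (LINT \<xi>|P. fm x y \<xi> + r_real y + a / 2 * (Lt x \<xi>)\<^sup>2 + sD y x \<xi> / (2 * a))"
    by (rule integral_mono_AE[OF _ _ AE_lip_young[OF assms]])
       (auto intro!: Bochner_Integration.integrable_add integrable_mult_right integrable_divide_zero)
  also have "\<dots> = (LINT \<xi>|P. fm x y \<xi>) + r_real y + a / 2 * (LINT \<xi>|P. (Lt x \<xi>)\<^sup>2) + Dw y x / (2 * a)"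
    by (simp add: integral_sD prob_space)
  also have "\<dots> \<le> exp_fun P fs y + \<tau> * Dw y x + r_real y + a / 2 * L\<^sup>2 + Dw y x / (2 * a)"
  proof -
    have "(LINT \<xi>|P. fm x y \<xi>) \<le> exp_fun P fs y + \<tau> * Dw y x"
      using integral_model_le[of x y] tau_pos
      by (auto intro: order_trans[OF _ add_left_mono[OF mult_left_mono]])
    moreover have "a / 2 * (LINT \<xi>|P. (Lt x \<xi>)\<^sup>2) \<le> a / 2 * L\<^sup>2"
      using integral_Lt assms(3) by (intro mult_left_mono) auto
    ultimately show ?thesis by linarith
  qed
  finally show ?thesis by (simp add: F_real_def integral_model_base prob_space)
qed

text \<open>Lower semicontinuity of \<open>F\<close> is not assumed. At points of \<open>dom r\<close> it follows from
  \<open>F_real_lip\<close>; elsewhere, by Fatou's lemma, from that of the models at a fixed \<open>x\<close> in \<open>dom r\<close>.\<close>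

lemma F_real_unbounded_off_dom:
  assumes y: "\<And>n. y n \<in> dom_r" "y \<longlonglongrightarrow> z" and z: "z \<notin> dom_r"
  shows "\<exists>n::nat. b < F_real (y n)"
proof (rule ccontr)
  assume "\<not> ?thesis"
  then have b: "F_real (y n) \<le> b" for n by (auto simp: not_less)
  obtain x where x: "x \<in> dom_r" using dom_r_nonempty by blast
  \<comment> \<open>The Lipschitz condition in Young form with weight \<open>1\<close> makes
    \<open>g n\<close> nonnegative almost everywhere, so Fatou's lemma applies to its
    \<open>ennreal\<close> values. A bound on \<open>F_real (y n)\<close> would bound the integrals,
    whereas the models tend to infinity.\<close>
  define g where "g n \<xi> = fm x (y n) \<xi> + r_real (y n) + (Lt x \<xi>)\<^sup>2 / 2 + sD (y n) x \<xi> / 2 - (fm x x \<xi> + r_real x)" for n \<xi>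
  have g_int [simp, intro]: "integrable P (g n)" for n
    unfolding g_def by (intro Bochner_Integration.integrable_add Bochner_Integration.integrable_diff integrable_divide_zero) auto
  have [measurable]: "g n \<in> borel_measurable P" for n
    by (rule borel_measurable_integrable[OF g_int])
  have g_nonneg: "AE \<xi> in P. 0 \<le> g n \<xi>" for n
    using AE_lip_young[OF x y(1)[of n], of 1] by (auto simp: g_def)
  obtain d where d: "\<And>n. Dw (y n) x \<le> d"
    using convergent_imp_Bseq[OF convergentI[OF tendsto_Dw[OF y(2)]]]
    by (metis BseqE abs_le_D1 real_norm_def)
  define C where "C = b + \<tau> * d + L\<^sup>2 / 2 + d / 2 - F_real x"
  have "(LINT \<xi>|P. g n \<xi>) \<le> C" for n
  proof -
    have "(LINT \<xi>|P. g n \<xi>) = (LINT \<xi>|P. fm x (y n) \<xi>) + r_real (y n) + (LINT \<xi>|P. (Lt x \<xi>)\<^sup>2) / 2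
        + Dw (y n) x / 2 - F_real x"
      unfolding g_def by (simp add: integral_sD prob_space integral_model_base F_real_def)
    moreover have "(LINT \<xi>|P. fm x (y n) \<xi>) \<le> exp_fun P fs (y n) + \<tau> * Dw (y n) x"
      using integral_model_le[of x "y n"] tau_pos
      by (auto intro: order_trans[OF _ add_left_mono[OF mult_left_mono]])
    moreover have "\<tau> * Dw (y n) x \<le> \<tau> * d" using d tau_pos by simp
    ultimately show ?thesis using integral_Lt[of x] b[of n] d[of n] unfolding C_def F_real_def by linarith
  qed
  then have "(\<integral>\<^sup>+\<xi>. ennreal (g n \<xi>) \<partial>P) \<le> ennreal C" for n
    by (subst nn_integral_eq_integral) (auto simp: g_nonneg ennreal_leI)
  then have "liminf (\<lambda>n. \<integral>\<^sup>+\<xi>. ennreal (g n \<xi>) \<partial>P) \<le> ennreal C"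
    by (intro order_trans[OF Liminf_le_Limsup Limsup_bounded]) auto
  moreover have "(\<integral>\<^sup>+\<xi>. liminf (\<lambda>n. ennreal (g n \<xi>)) \<partial>P) \<le> liminf (\<lambda>n. \<integral>\<^sup>+\<xi>. ennreal (g n \<xi>) \<partial>P)"
    by (intro nn_integral_liminf) measurable
  moreover have "AE \<xi> in P. liminf (\<lambda>n. ennreal (g n \<xi>)) = \<infinity>"
  proof -
    have "AE \<xi> in P. lsc_fun (model_obj fm r x \<xi>)"
      using setting unfolding setting_def by auto
    then show ?thesis using AE_regular
    proof eventually_elim
      case (elim \<xi>)
      have "model_obj fm r x \<xi> z = \<infinity>" by (simp add: model_obj_def r_notin_dom[OF z])
      then have "Liminf (at z) (model_obj fm r x \<xi>) = \<infinity>"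
        using elim(1) unfolding lsc_fun_def by (metis ereal_infty_less_eq(1))
      moreover have "y n \<noteq> z" for n using y(1)[of n] z by auto
      then have "filterlim y (at z) sequentially"
        using y(2) by (simp add: filterlim_at)
      ultimately have "(\<lambda>n. model_obj fm r x \<xi> (y n)) \<longlonglongrightarrow> \<infinity>"
        by (metis filterlim_compose Liminf_PInfty trivial_limit_at)
      then have lim: "filterlim (\<lambda>n. fm x (y n) \<xi> + r_real (y n)) at_top sequentially"
        using y(1) by (simp add: model_obj_def r_dom tendsto_PInfty_eq_at_top)
      have "filterlim (\<lambda>n. g n \<xi>) at_top sequentially"
      proof (rule filterlim_at_top_mono[OF filterlim_tendsto_add_at_top[OF tendsto_const lim]])
        show "\<forall>\<^sub>F n in sequentially. - (fm x x \<xi> + r_real x) + (fm x (y n) \<xi> + r_real (y n)) \<le> g n \<xi>"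
          using sD_nonneg[OF elim(2)] by (intro always_eventually allI) (auto simp: g_def)
      qed
      then have "(\<lambda>n. ennreal (g n \<xi>)) \<longlonglongrightarrow> \<infinity>"
        by (simp add: ennreal_tendsto_top_eq_at_top)
      then show ?case by (simp add: lim_imp_Liminf)
    qed
  qed
  then have "(\<integral>\<^sup>+\<xi>. liminf (\<lambda>n. ennreal (g n \<xi>)) \<partial>P) = (\<integral>\<^sup>+\<xi>. \<infinity> \<partial>P)"
    by (intro nn_integral_cong_AE)
  ultimately show False by (simp add: emeasure_space_1 top_unique)
qed

section \<open>The proximal subproblem and its envelope\<close>

abbreviation prox :: "real ^ 'd \<Rightarrow> real ^ 'd" where "prox \<equiv> bregman_prox \<omega> lam F"

definition \<beta> :: real where "\<beta> = 1 / lam - \<rho> - \<tau>"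

lemma \<beta>_pos: "0 < \<beta>"
proof -
  have "\<rho> + \<tau> < 1 / lam"
    using lam_less lam_pos rho_pos tau_pos by (simp add: field_simps)
  then show ?thesis by (simp add: \<beta>_def)
qed

definition psi :: "real ^ 'd \<Rightarrow> real ^ 'd \<Rightarrow> real" where
  "psi x y = F_real y + Dw y x / lam"

definition Finf :: real where "Finf = real_of_ereal (INF x. F x)"

lemma INF_F: "(INF x. F x) = ereal Finf"
proof -
  obtain x where x: "x \<in> dom_r" using dom_r_nonempty by blast
  have "(INF x. F x) \<le> ereal (F_real x)" using F_dom[OF x] by (metis INF_lower UNIV_I)
  moreover have "- \<infinity> < (INF x. F x)" using setting by (simp add: setting_def)
  ultimately show ?thesis unfolding Finf_def by (cases "INF x. F x") auto
qed

lemma Finf_le: "x \<in> dom_r \<Longrightarrow> Finf \<le> F_real x"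
  using INF_lower[of x UNIV F] by (simp add: INF_F F_dom)

text \<open>The shape required by \<open>convex_three_point\<close>: convex part, smooth part with
  modulus \<beta>, linear part, constant.\<close>

lemma psi_split:
  "psi x y = (F_real y + (\<rho> + \<tau>) * \<omega> y) + \<beta> * \<omega> y + (- grad \<omega> x /\<^sub>R lam) \<bullet> y + (grad \<omega> x \<bullet> x - \<omega> x) / lam"
  using lam_pos by (simp add: psi_def bregman_def \<beta>_def inner_diff_right field_simps)

text \<open>Each endpoint is half of \<open>y - z\<close> away from the midpoint, in opposite
  directions, so the gradient terms cancel and the quadratic bounds of \<open>Dw_ge\<close> give the
  factor \<open>1 / 8\<close>.\<close>

lemma psi_midpoint:
  assumes "y \<in> dom_r" "z \<in> dom_r"
  shows "psi x ((1/2) *\<^sub>R y + (1/2) *\<^sub>R z) \<le> psi x y / 2 + psi x z / 2 - \<beta> / 8 * (norm (y - z))\<^sup>2"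
proof -
  define m where "m = (1/2) *\<^sub>R y + (1/2) *\<^sub>R z"
  define G where "G = (\<lambda>y. F_real y + (\<rho> + \<tau>) * \<omega> y)"
  have "G m \<le> G y / 2 + G z / 2"
    unfolding m_def using convex_onD[OF convex_on_F_real, of "1/2" y z] assms by (simp add: G_def)
  moreover have "\<omega> m \<le> \<omega> y / 2 + \<omega> z / 2 - (norm (y - z))\<^sup>2 / 8"
  proof -
    have y: "y - m = (1/2) *\<^sub>R (y - z)" and z: "z - m = - ((1/2) *\<^sub>R (y - z))"
      by (simp_all add: m_def vec_eq_iff field_simps)
    have "(norm (y - z))\<^sup>2 / 8 \<le> Dw y m" "(norm (y - z))\<^sup>2 / 8 \<le> Dw z m"
      using Dw_ge[of y m] Dw_ge[of z m] unfolding y z by (simp_all add: power_divide)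
    then show ?thesis unfolding bregman_def y z by (simp add: inner_minus_right)
  qed
  then have "\<beta> * \<omega> m \<le> \<beta> * (\<omega> y / 2 + \<omega> z / 2 - (norm (y - z))\<^sup>2 / 8)"
    using \<beta>_pos by simp
  then have "\<beta> * \<omega> m \<le> \<beta> * \<omega> y / 2 + \<beta> * \<omega> z / 2 - \<beta> / 8 * (norm (y - z))\<^sup>2"
    by (simp add: algebra_simps)
  moreover have "(- grad \<omega> x /\<^sub>R lam) \<bullet> m = (- grad \<omega> x /\<^sub>R lam) \<bullet> y / 2 + (- grad \<omega> x /\<^sub>R lam) \<bullet> z / 2"
    by (simp add: m_def inner_add_right)
  ultimately show ?thesis
    unfolding psi_split m_def[symmetric] G_def by (simp add: add_divide_distrib diff_divide_distrib)
qed

lemma psi_bounded: "y \<in> dom_r \<Longrightarrow> Finf \<le> psi x y"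
  using Finf_le[of y] Dw_nonneg[of y x] lam_pos by (simp add: psi_def add_increasing2)

text \<open>By the midpoint inequality a minimizing sequence is Cauchy. Its limit lies in
  \<open>edom r\<close>, since otherwise the objective would be unbounded along the sequence, and on
  \<open>edom r\<close> lower semicontinuity shows that the limit is minimal.\<close>

lemma psi_minimizer_exists: "\<exists>p\<in>dom_r. \<forall>z\<in>dom_r. psi x p \<le> psi x z"
proof -
  define I where "I = Inf (psi x ` dom_r)"
  have bdd: "bdd_below (psi x ` dom_r)" using psi_bounded by (auto intro!: bdd_belowI2)
  have I_le: "I \<le> psi x z" if "z \<in> dom_r" for z
    unfolding I_def using bdd that by (intro cInf_lower) auto
  have "\<exists>y\<in>dom_r. psi x y < I + 1 / real (Suc n)" for n
    unfolding I_def using cInf_lessD[of "psi x ` dom_r" "Inf (psi x ` dom_r) + 1 / real (Suc n)"] dom_r_nonempty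
    by auto
  then obtain y where y: "\<And>n. y n \<in> dom_r" "\<And>n. psi x (y n) < I + 1 / real (Suc n)" by metis
  have ylim: "(\<lambda>n. psi x (y n)) \<longlonglongrightarrow> I"
  proof (rule tendsto_sandwich[OF _ _ tendsto_const])
    show "(\<lambda>n. I + 1 / real (Suc n)) \<longlonglongrightarrow> I" by real_asymp
    show "\<forall>\<^sub>F n in sequentially. I \<le> psi x (y n)" using I_le y(1) by simp
    show "\<forall>\<^sub>F n in sequentially. psi x (y n) \<le> I + 1 / real (Suc n)"
      using y(2) by (intro always_eventually allI less_imp_le)
  qed
  have close: "\<beta> / 8 * (norm (y i - y j))\<^sup>2 \<le> psi x (y i) / 2 + psi x (y j) / 2 - I" for i j
  proof -
    have "(1/2) *\<^sub>R y i + (1/2) *\<^sub>R y j \<in> dom_r"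
      using y(1) by (intro convexD[OF convex_dom_r]) auto
    from I_le[OF this] psi_midpoint[OF y(1)[of i] y(1)[of j], of x] show ?thesis by linarith
  qed
  have "Cauchy y"
  proof (rule metric_CauchyI)
    fix e :: real assume e: "0 < e"
    obtain N where N: "8 / \<beta> * (1 / real (Suc N)) < e\<^sup>2"
    proof -
      have "(\<lambda>n. 8 / \<beta> * (1 / real (Suc n))) \<longlonglongrightarrow> 8 / \<beta> * 0"
        by (intro tendsto_intros) real_asymp
      then have "eventually (\<lambda>n. 8 / \<beta> * (1 / real (Suc n)) < e\<^sup>2) sequentially"
        using e by (intro order_tendstoD(2)) auto
      then show ?thesis using that by (auto simp: eventually_sequentially)
    qed
    have "dist (y i) (y j) < e" if "N \<le> i" "N \<le> j" for i j
    proof -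
      have "1 / real (Suc i) \<le> 1 / real (Suc N)" "1 / real (Suc j) \<le> 1 / real (Suc N)"
        using that by (auto intro!: divide_left_mono)
      then have "\<beta> / 8 * (norm (y i - y j))\<^sup>2 \<le> 1 / real (Suc N)"
        using close[of i j] y(2)[of i] y(2)[of j] by linarith
      then have "(norm (y i - y j))\<^sup>2 \<le> 8 / \<beta> * (1 / real (Suc N))"
        using \<beta>_pos mult_left_mono[of "\<beta> / 8 * (norm (y i - y j))\<^sup>2" "1 / real (Suc N)" "8 / \<beta>"] by simp
      then have "(norm (y i - y j))\<^sup>2 < e\<^sup>2" using N by linarith
      then show ?thesis using e by (simp add: dist_norm power2_less_imp_less)
    qed
    then show "\<exists>M. \<forall>m\<ge>M. \<forall>n\<ge>M. dist (y m) (y n) < e" by blast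
  qed
  then obtain p where p: "y \<longlonglongrightarrow> p" using convergent_eq_Cauchy by blast
  have "p \<in> dom_r"
  proof (rule ccontr)
    assume "p \<notin> dom_r"
    from F_real_unbounded_off_dom[OF y(1) p this, of "I + 1"] obtain n where "I + 1 < F_real (y n)" by blast
    moreover have "F_real (y n) \<le> psi x (y n)"
      using Dw_nonneg[of "y n" x] lam_pos by (simp add: psi_def)
    moreover have "1 / real (Suc n) \<le> 1" by simp
    ultimately show False using y(2)[of n] by linarith
  qed
  moreover have "psi x p \<le> psi x z" if z: "z \<in> dom_r" for z
  proof -
    have "psi x p \<le> I + a" if a: "0 < a" for a
    proof -
      \<comment> \<open>Chosen so that the Young error \<open>a' / 2 * L\<^sup>2\<close> is at most
        \<open>a\<close>.\<close>
      define a' where "a' = 2 * a / (L\<^sup>2 + 1)"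
      have a': "0 < a'" using a by (simp add: a'_def add_nonneg_pos)
      have "0 < L\<^sup>2 + 1" by (simp add: add_nonneg_pos)
      then have "a' / 2 * L\<^sup>2 \<le> a" using a by (simp add: a'_def pos_divide_le_eq algebra_simps)
      then have "psi x p \<le> psi x (y n) - Dw (y n) x / lam + \<tau> * Dw (y n) p + a + Dw (y n) p / (2 * a') + Dw p x / lam" for n
        using F_real_lip[OF \<open>p \<in> dom_r\<close> y(1)[of n] a'] by (simp add: psi_def)
      moreover have "(\<lambda>n. psi x (y n) - Dw (y n) x / lam + \<tau> * Dw (y n) p + a + Dw (y n) p / (2 * a') + Dw p x / lam)
        \<longlonglongrightarrow> I - Dw p x / lam + \<tau> * Dw p p + a + Dw p p / (2 * a') + Dw p x / lam"
        using a' lam_pos by (intro tendsto_intros ylim tendsto_Dw p) auto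
      ultimately have "psi x p \<le> I - Dw p x / lam + \<tau> * Dw p p + a + Dw p p / (2 * a') + Dw p x / lam"
        by (intro LIMSEQ_le_const) auto
      then show ?thesis by (simp add: bregman_def)
    qed
    then have "psi x p \<le> I" by (rule field_le_epsilon)
    then show ?thesis using I_le[OF z] by linarith
  qed
  ultimately show ?thesis by blast
qed

lemma prox_obj: "F y + ereal (1 / lam * Dw y x) = (if y \<in> dom_r then ereal (psi x y) else \<infinity>)"
  by (simp add: F_dom F_notin_dom psi_def)

text \<open>\<open>arg_min\<close> chooses among the minimizers, so the existence of one makes
  \<open>prox x\<close> a minimizer.\<close>

lemma prox_dom: "prox x \<in> dom_r"
  and prox_min: "z \<in> dom_r \<Longrightarrow> psi x (prox x) \<le> psi x z"
proof -
  let ?f = "\<lambda>y. F y + ereal (1 / lam * Dw y x)"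
  obtain p where p: "p \<in> dom_r" "\<And>z. z \<in> dom_r \<Longrightarrow> psi x p \<le> psi x z"
    using psi_minimizer_exists by blast
  have "is_arg_min ?f (\<lambda>_. True) p"
    using p unfolding is_arg_min_def prox_obj by (auto simp: not_less)
  then have "is_arg_min ?f (\<lambda>_. True) (prox x)"
    unfolding bregman_prox_def arg_min_def by (rule someI)
  then have *: "?f (prox x) \<le> ?f z" for z by (auto simp: is_arg_min_def not_less)
  show dom: "prox x \<in> dom_r" using *[of p] p(1) unfolding prox_obj by (auto split: if_splits)
  show "psi x (prox x) \<le> psi x z" if "z \<in> dom_r"
    using *[of z] dom that unfolding prox_obj by auto
qed

definition env :: "real ^ 'd \<Rightarrow> real" where "env x = psi x (prox x)"

lemma bregman_env_eq: "bregman_env \<omega> lam F x = ereal (env x)"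
  unfolding bregman_env_def prox_obj env_def
proof (rule antisym)
  show "(INF y. if y \<in> dom_r then ereal (psi x y) else \<infinity>) \<le> ereal (psi x (prox x))"
    by (rule INF_lower2[of "prox x"]) (auto simp: prox_dom)
  show "ereal (psi x (prox x)) \<le> (INF y. if y \<in> dom_r then ereal (psi x y) else \<infinity>)"
    by (rule INF_greatest) (simp add: prox_min)
qed

lemma Finf_le_env: "Finf \<le> env x"
  unfolding env_def by (intro psi_bounded prox_dom)

text \<open>The choice \<open>z = x\<close> supplies the reverse distance
  \<open>Dw x (prox x)\<close>, the second half of the symmetrized distance.\<close>

lemma prox_three_point:
  assumes z: "z \<in> dom_r"
  shows "psi x (prox x) + \<beta> * Dw z (prox x) \<le> psi x z"
proof -
  define p where "p = prox x"
  have p: "p \<in> dom_r" by (simp add: p_def prox_dom)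
  define a where "a n = 1 / real (n + 2)" for n
  have a: "0 < a n" "a n \<le> 1" for n by (auto simp: a_def)
  have a0: "a \<longlonglongrightarrow> 0" unfolding a_def by real_asymp
  have "(F_real p + (\<rho> + \<tau>) * \<omega> p) + \<beta> * \<omega> p + (- grad \<omega> x /\<^sub>R lam) \<bullet> p
      + \<beta> * (\<omega> z - \<omega> p - grad \<omega> p \<bullet> (z - p))
    \<le> (F_real z + (\<rho> + \<tau>) * \<omega> z) + \<beta> * \<omega> z + (- grad \<omega> x /\<^sub>R lam) \<bullet> z"
  proof (rule convex_three_point[OF convex_on_F_real gderiv_omega p z a0 a])
    fix n
    have "p + a n *\<^sub>R (z - p) = (1 - a n) *\<^sub>R p + a n *\<^sub>R z" by (simp add: algebra_simps)
    then have "p + a n *\<^sub>R (z - p) \<in> dom_r"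
      using convexD[OF convex_dom_r p z, of "1 - a n" "a n"] a[of n] by simp
    then have "psi x p \<le> psi x (p + a n *\<^sub>R (z - p))" unfolding p_def by (rule prox_min)
    then show "F_real p + (\<rho> + \<tau>) * \<omega> p + \<beta> * \<omega> p + (- grad \<omega> x /\<^sub>R lam) \<bullet> p
      \<le> F_real (p + a n *\<^sub>R (z - p)) + (\<rho> + \<tau>) * \<omega> (p + a n *\<^sub>R (z - p)) + \<beta> * \<omega> (p + a n *\<^sub>R (z - p))
        + (- grad \<omega> x /\<^sub>R lam) \<bullet> (p + a n *\<^sub>R (z - p))"
      unfolding psi_split by linarith
  qed
  then show ?thesis unfolding p_def[symmetric] psi_split bregman_def by linarith
qed

text \<open>Add the three-point inequalities at both proximal points: the objective and \<omega>
  cancel, leaving the gradient difference paired with the difference of the proximal points.\<close>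

lemma prox_lipschitz_grad: "\<beta> * lam * norm (prox x - prox y) \<le> norm (grad \<omega> x - grad \<omega> y)"
proof -
  let ?p = "prox x" and ?q = "prox y"
  have "psi x ?p + \<beta> * Dw ?q ?p \<le> psi x ?q" "psi y ?q + \<beta> * Dw ?p ?q \<le> psi y ?p"
    by (auto intro!: prox_three_point prox_dom)
  moreover have "\<beta> * ((norm (?p - ?q))\<^sup>2 / 2) \<le> \<beta> * Dw ?q ?p" "\<beta> * ((norm (?p - ?q))\<^sup>2 / 2) \<le> \<beta> * Dw ?p ?q"
    using Dw_ge[of ?q ?p] Dw_ge[of ?p ?q] \<beta>_pos by (simp_all add: norm_minus_commute)
  ultimately have "\<beta> * (norm (?p - ?q))\<^sup>2 \<le> psi x ?q - psi x ?p + (psi y ?p - psi y ?q)"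
    by linarith
  also have "\<dots> = ((grad \<omega> x - grad \<omega> y) \<bullet> (?p - ?q)) / lam"
    unfolding psi_split using lam_pos
    by (simp add: inner_diff_left inner_diff_right field_simps)
  also have "\<dots> \<le> norm (grad \<omega> x - grad \<omega> y) * norm (?p - ?q) / lam"
    using lam_pos by (intro divide_right_mono norm_cauchy_schwarz) auto
  finally have "norm (?p - ?q) * (\<beta> * lam * norm (?p - ?q)) \<le> norm (?p - ?q) * norm (grad \<omega> x - grad \<omega> y)"
    using lam_pos by (simp add: field_simps power2_eq_square)
  then show ?thesis by (cases "?p = ?q") auto
qed

section \<open>Measurability of the proximal map, the objective and the envelope\<close>

lemma measurable_omega [measurable]: "\<omega> \<in> borel_measurable borel"
  using continuous_omega by (rule borel_measurable_continuous_onI)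

lemma measurable_grad [measurable]: "grad \<omega> \<in> borel_measurable borel"
proof -
  have [measurable]: "(\<lambda>(x, \<xi>). gt x \<xi>) \<in> borel_measurable (borel \<Otimes>\<^sub>M P)"
    using dgf by (simp add: dgf_condition_def)
  have "(\<lambda>x. LINT \<xi>|P. gt x \<xi>) \<in> borel_measurable borel" by measurable
  then show ?thesis by (simp add: integral_dgf)
qed

text \<open>\<open>prox x\<close> is a Lipschitz function of \<open>grad \<omega> x\<close>.\<close>

lemma measurable_prox [measurable]: "prox \<in> borel_measurable borel"
proof -
  define T where "T g = prox (inv_into UNIV (grad \<omega>) g)" for g
  have bl: "0 < \<beta> * lam" using \<beta>_pos lam_pos by simp
  have T_lip: "dist (T g) (T h) \<le> 1 / (\<beta> * lam) * dist g h" if "g \<in> range (grad \<omega>)" "h \<in> range (grad \<omega>)" for g h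
    using prox_lipschitz_grad[of "inv_into UNIV (grad \<omega>) g" "inv_into UNIV (grad \<omega>) h"] that bl
    by (simp add: T_def dist_norm f_inv_into_f field_simps)
  have "(1 / (\<beta> * lam))-lipschitz_on (range (grad \<omega>)) T"
    using bl by (intro lipschitz_onI T_lip) auto
  then have "continuous_on (range (grad \<omega>)) T" by (rule lipschitz_on_continuous_on)
  then have "T \<in> borel_measurable (restrict_space borel (range (grad \<omega>)))"
    by (rule borel_measurable_continuous_on_restrict)
  moreover have "grad \<omega> \<in> measurable borel (restrict_space borel (range (grad \<omega>)))"
    by (intro measurable_restrict_space2) auto
  ultimately have "(\<lambda>x. T (grad \<omega> x)) \<in> borel_measurable borel" by (rule measurable_compose[rotated])
  \<comment> \<open>\<open>inv_into\<close> may return another point with the same gradient; the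
    Lipschitz bound shows that its proximal point is the same.\<close>
  moreover have "T (grad \<omega> x) = prox x" for x
    using prox_lipschitz_grad[of "inv_into UNIV (grad \<omega>) (grad \<omega> x)" x] \<beta>_pos lam_pos
    by (simp add: T_def f_inv_into_f mult_le_0_iff)
  ultimately show ?thesis by simp
qed

lemma measurable_r_real [measurable]: "r_real \<in> borel_measurable borel"
proof -
  have "r \<in> borel_measurable borel" using setting by (intro borel_measurable_lsc) (simp add: setting_def)
  then show ?thesis unfolding r_real_def[abs_def] by measurable
qed

lemma sets_dom_r [measurable]: "dom_r \<in> sets borel"
proof -
  have [measurable]: "r \<in> borel_measurable borel" using setting by (intro borel_measurable_lsc) (simp add: setting_def)
  have "{x \<in> space borel. r x < \<infinity>} \<in> sets borel" by measurable
  then show ?thesis by (simp add: edom_def)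
qed

lemma measurable_fm [measurable (raw)]:
  assumes [measurable]: "u \<in> borel_measurable N" "v \<in> borel_measurable N" "w \<in> measurable N P"
  shows "(\<lambda>z. fm (u z) (v z) (w z)) \<in> borel_measurable N"
proof -
  have fm: "(\<lambda>(x, y, \<xi>). fm x y \<xi>) \<in> borel_measurable (borel \<Otimes>\<^sub>M borel \<Otimes>\<^sub>M P)"
    using setting by (simp add: setting_def)
  have "(\<lambda>z. (u z, v z, w z)) \<in> measurable N (borel \<Otimes>\<^sub>M borel \<Otimes>\<^sub>M P)" by measurable
  from measurable_compose[OF this fm] show ?thesis by simp
qed

lemma measurable_sD [measurable (raw)]:
  assumes [measurable]: "u \<in> borel_measurable N" "v \<in> borel_measurable N" "w \<in> measurable N P"
  shows "(\<lambda>z. sD (u z) (v z) (w z)) \<in> borel_measurable N"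
proof -
  have wt: "(\<lambda>(x, \<xi>). \<omega>t x \<xi>) \<in> borel_measurable (borel \<Otimes>\<^sub>M P)"
    and gt: "(\<lambda>(x, \<xi>). gt x \<xi>) \<in> borel_measurable (borel \<Otimes>\<^sub>M P)"
    using dgf by (auto simp: dgf_condition_def)
  have [measurable]: "(\<lambda>z. \<omega>t (q z) (w z)) \<in> borel_measurable N" "(\<lambda>z. gt (q z) (w z)) \<in> borel_measurable N"
    if [measurable]: "q \<in> borel_measurable N" for q
  proof -
    have *: "(\<lambda>z. (q z, w z)) \<in> measurable N (borel \<Otimes>\<^sub>M P)" by measurable
    show "(\<lambda>z. \<omega>t (q z) (w z)) \<in> borel_measurable N" using measurable_compose[OF * wt] by simp
    show "(\<lambda>z. gt (q z) (w z)) \<in> borel_measurable N" using measurable_compose[OF * gt] by simp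
  qed
  show ?thesis unfolding sbregman_def by measurable
qed

text \<open>Joint measurability is given for the models, not for \<open>fs\<close>; the expected
  objective is recovered from the models on the diagonal.\<close>

lemma measurable_F_real [measurable]: "F_real \<in> borel_measurable borel"
proof -
  have "(\<lambda>x. LINT \<xi>|P. fm x x \<xi>) \<in> borel_measurable borel" by measurable
  then show ?thesis unfolding F_real_def[abs_def] by (simp add: integral_model_base)
qed

lemma measurable_Dw [measurable (raw)]:
  assumes [measurable]: "u \<in> borel_measurable N" "v \<in> borel_measurable N"
  shows "(\<lambda>z. Dw (u z) (v z)) \<in> borel_measurable N"
  unfolding bregman_def by measurable

lemma measurable_env [measurable]: "env \<in> borel_measurable borel"
  unfolding env_def[abs_def] psi_def by measurable

section \<open>A single stochastic subproblem\<close>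

definition obj :: "real \<Rightarrow> nat \<Rightarrow> real ^ 'd \<Rightarrow> (nat \<Rightarrow> 'a) \<Rightarrow> real ^ 'd \<Rightarrow> real" where
  "obj t m x B y = (1 / real m) * (\<Sum>i<m. fm x y (B i) + r_real y + (1 / t) * sD y x (B i))"

text \<open>The per-sample bound left once Young's inequality has eliminated the new iterate. For
  fixed \<open>x\<close> and \<open>z\<close> it is an integrable function of one sample, so only
  the marginal law of each sample enters its mean.\<close>

definition step_gap :: "real \<Rightarrow> real ^ 'd \<Rightarrow> real ^ 'd \<Rightarrow> 'a \<Rightarrow> real" where
  "step_gap t x z \<xi> = fm x z \<xi> + r_real z - (fm x x \<xi> + r_real x) + (1 / t) * sD z x \<xi> + t / 4 * (Lt x \<xi>)\<^sup>2"

lemma batch_obj_eq: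
  assumes "0 < m"
  shows "batch_obj fm r \<omega>t gt t m x B y = (if y \<in> dom_r then ereal (obj t m x B y) else \<infinity>)"
proof (cases "y \<in> dom_r")
  case True
  then show ?thesis by (simp add: batch_obj_def obj_def r_dom)
next
  case False
  have "(\<Sum>i<m. ereal (fm x y (B i)) + r y + ereal ((1 / t) * sD y x (B i))) = \<infinity>"
    using False assms by (subst sum_Pinfty) (auto simp: r_notin_dom)
  then show ?thesis using False assms by (simp add: batch_obj_def)
qed

text \<open>The batch averages \<open>G\<close>, \<open>W\<close> and \<open>U\<close> put the
  subproblem into the form of \<open>convex_three_point\<close>: the base point \<open>x\<close>
  enters only a linear term and a constant.\<close>

lemma batch_three_point:
  assumes regular: "\<And>i. i < m \<Longrightarrow> regular (B i)"
    and conv: "\<And>i. i < m \<Longrightarrow> convex_on dom_r (\<lambda>y. fm x y (B i) + r_real y + \<rho> * \<omega>t y (B i))"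
    and y: "y \<in> dom_r" and z: "z \<in> dom_r"
    and a: "a \<longlonglongrightarrow> 0" "\<And>n. 0 < a n" "\<And>n. a n \<le> 1"
    and min: "\<And>n::nat. obj t m x B y \<le> obj t m x B (y + a n *\<^sub>R (z - y))"
  shows "obj t m x B y + (1 / t - \<rho>) * sbregman_batch \<omega>t gt m z y B \<le> obj t m x B z"
proof -
  define G where "G y = (1 / real m) * (\<Sum>i<m. fm x y (B i) + r_real y + \<rho> * \<omega>t y (B i))" for y
  define W where "W y = (1 / real m) * (\<Sum>i<m. \<omega>t y (B i))" for y
  define U where "U y = (1 / real m) *\<^sub>R (\<Sum>i<m. gt y (B i))" for y
  have obj: "obj t m x B q = G q + (1 / t - \<rho>) * W q + (- U x /\<^sub>R t) \<bullet> q + (U x \<bullet> x - W x) / t" for q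
  proof -
    have "obj t m x B q = (1 / real m) * (\<Sum>i<m. (fm x q (B i) + r_real q + \<rho> * \<omega>t q (B i))
        + (1 / t - \<rho>) * \<omega>t q (B i) - (1 / t) * (gt x (B i) \<bullet> q)
        + (1 / t) * (gt x (B i) \<bullet> x) - (1 / t) * \<omega>t x (B i))"
      unfolding obj_def by (intro arg_cong2[where f = "(*)"] sum.cong refl)
        (simp add: sbregman_def inner_diff_right algebra_simps)
    also have "\<dots> = G q + (1 / t - \<rho>) * W q - (1 / t) * (U x \<bullet> q) + (1 / t) * (U x \<bullet> x) - (1 / t) * W x"
      unfolding G_def W_def U_def
      by (simp only: sum.distrib sum_subtractf sum_distrib_left[symmetric] inner_scaleR_left inner_sum_left)
         (simp add: algebra_simps diff_divide_distrib)
    finally show ?thesis by (simp add: diff_divide_distrib inverse_eq_divide algebra_simps)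
  qed
  have batch: "sbregman_batch \<omega>t gt m z y B = W z - W y - U y \<bullet> (z - y)"
    unfolding sbregman_batch_def sbregman_def W_def U_def
    by (simp add: sum_subtractf inner_sum_left right_diff_distrib)
  have "convex_on dom_r G" unfolding G_def
    by (intro convex_on_cmul convex_on_sum_fun conv convex_dom_r) auto
  moreover have "GDERIV W y :> U y" unfolding W_def[abs_def] U_def
    using regular by (intro gderiv_scale gderiv_sum) (auto simp: regular_def)
  ultimately have "G y + (1 / t - \<rho>) * W y + (- U x /\<^sub>R t) \<bullet> y + (1 / t - \<rho>) * (W z - W y - U y \<bullet> (z - y))
    \<le> G z + (1 / t - \<rho>) * W z + (- U x /\<^sub>R t) \<bullet> z"
    using min unfolding obj by (intro convex_three_point[OF _ _ y z a]) auto
  then show ?thesis unfolding obj batch by linarith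
qed

lemma batch_step_gap:
  assumes regular: "\<And>i. i < m \<Longrightarrow> regular (B i)"
    and conv: "\<And>i. i < m \<Longrightarrow> convex_on dom_r (\<lambda>y. fm x y (B i) + r_real y + \<rho> * \<omega>t y (B i))"
    and lip: "\<And>i. i < m \<Longrightarrow> fm x x (B i) + r_real x \<le> fm x y (B i) + r_real y + Lt x (B i) * sqrt (sD y x (B i))"
    and y: "y \<in> dom_r" and z: "z \<in> dom_r" and t: "0 < t"
    and a: "a \<longlonglongrightarrow> 0" "\<And>n. 0 < a n" "\<And>n. a n \<le> 1"
    and min: "\<And>n::nat. obj t m x B y \<le> obj t m x B (y + a n *\<^sub>R (z - y))"
  shows "(1 / t - \<rho>) * sbregman_batch \<omega>t gt m z y B \<le> (1 / real m) * (\<Sum>i<m. step_gap t x z (B i))"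
proof -
  \<comment> \<open>With weight \<open>t / 2\<close> the distance term of Young's inequality is
    exactly the proximal term of the subproblem.\<close>
  have "fm x x (B i) + r_real x - t / 4 * (Lt x (B i))\<^sup>2 \<le> fm x y (B i) + r_real y + (1 / t) * sD y x (B i)"
    if "i < m" for i
    using lip[OF that] young_sqrt[OF sD_nonneg[OF regular[OF that]], of "t / 2" "Lt x (B i)" y x] t by simp
  then have "(1 / real m) * (\<Sum>i<m. fm x x (B i) + r_real x - t / 4 * (Lt x (B i))\<^sup>2) \<le> obj t m x B y"
    unfolding obj_def by (intro mult_left_mono sum_mono) auto
  then have "(1 / t - \<rho>) * sbregman_batch \<omega>t gt m z y B
    \<le> obj t m x B z - (1 / real m) * (\<Sum>i<m. fm x x (B i) + r_real x - t / 4 * (Lt x (B i))\<^sup>2)"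
    using batch_three_point[OF regular conv y z a min] by simp
  also have "\<dots> = (1 / real m) * (\<Sum>i<m. step_gap t x z (B i))"
    unfolding obj_def step_gap_def right_diff_distrib[symmetric] sum_subtractf[symmetric]
    by (intro arg_cong2[where f = "(*)"] sum.cong refl) simp
  finally show ?thesis .
qed

definition step_bound :: "real \<Rightarrow> real ^ 'd \<Rightarrow> real" where
  "step_bound t x = F_real (prox x) - F_real x + (\<tau> + 1 / t) * Dw (prox x) x + t / 4 * L\<^sup>2"

lemma integrable_step_gap [simp, intro]: "integrable P (step_gap t x z)"
  unfolding step_gap_def[abs_def]
  by (intro Bochner_Integration.integrable_add Bochner_Integration.integrable_diff integrable_mult_right) auto

lemma integral_step_gap:
  assumes "0 < t"
  shows "(LINT \<xi>|P. step_gap t x (prox x) \<xi>) \<le> step_bound t x"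
proof -
  let ?z = "prox x"
  have "(LINT \<xi>|P. step_gap t x ?z \<xi>)
    = (LINT \<xi>|P. fm x ?z \<xi>) + r_real ?z - F_real x + (1 / t) * Dw ?z x + t / 4 * (LINT \<xi>|P. (Lt x \<xi>)\<^sup>2)"
    unfolding step_gap_def by (simp add: integral_sD prob_space integral_model_base F_real_def)
  moreover have "(LINT \<xi>|P. fm x ?z \<xi>) \<le> exp_fun P fs ?z + \<tau> * Dw ?z x"
    using integral_model_le[of x ?z] tau_pos
    by (auto intro: order_trans[OF _ add_left_mono[OF mult_left_mono]])
  moreover have "t / 4 * (LINT \<xi>|P. (Lt x \<xi>)\<^sup>2) \<le> t / 4 * L\<^sup>2"
    using integral_Lt assms by (intro mult_left_mono) auto
  ultimately show ?thesis by (simp add: step_bound_def F_real_def distrib_right)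
qed

text \<open>The base point is fixed here, so null sets that depend on it are harmless. The index set
  consists of the coordinates of batch \<open>k\<close> in the space of all samples.\<close>

lemma nn_integral_batch_le:
  fixes k :: 'k
  assumes x: "x \<in> dom_r" and t: "0 < t" "t < 1 / \<rho>" and m: "0 < m"
    and a: "a \<longlonglongrightarrow> 0" "\<And>n::nat. 0 < a n" "\<And>n. a n \<le> 1"
    and Y: "AE z in Pi\<^sub>M ({k} \<times> {..<m}) (\<lambda>_. P). Y z \<in> dom_r \<and>
      (\<forall>n. obj t m x (\<lambda>i. z (k, i)) (Y z) \<le> obj t m x (\<lambda>i. z (k, i)) (Y z + a n *\<^sub>R (prox x - Y z)))"
  shows "(\<integral>\<^sup>+z. ennreal ((1 / t - \<rho>) * sbregman_batch \<omega>t gt m (prox x) (Y z) (\<lambda>i. z (k, i)))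
      \<partial>Pi\<^sub>M ({k} \<times> {..<m}) (\<lambda>_. P)) \<le> ennreal (step_bound t x)"
proof -
  let ?J = "{k} \<times> {..<m}"
  let ?R = "Pi\<^sub>M ?J (\<lambda>_. P)"
  let ?h = "\<lambda>z. (1 / real m) * (\<Sum>i<m. step_gap t x (prox x) (z (k, i)))"
  interpret R: prob_space ?R by (intro prob_space_PiM) (rule prob_space_axioms)
  have comp: "AE z in ?R. \<forall>i<m. Q (z (k, i))" if "AE \<xi> in P. Q \<xi>" for Q
    unfolding Ball_def[of "{..<m}", unfolded lessThan_iff, symmetric]
    by (intro AE_finite_allI AE_PiM_component[where P = Q] that prob_space_axioms) auto
  have t\<rho>: "0 \<le> 1 / t - \<rho>" using t rho_pos by (simp add: field_simps)
  have "AE z in ?R. 0 \<le> (1 / t - \<rho>) * sbregman_batch \<omega>t gt m (prox x) (Y z) (\<lambda>i. z (k, i)) \<and>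
     (1 / t - \<rho>) * sbregman_batch \<omega>t gt m (prox x) (Y z) (\<lambda>i. z (k, i)) \<le> ?h z"
    using Y comp[OF AE_regular] comp[OF AE_convex_on[of x]] comp[OF AE_lip_all[OF x]]
  proof eventually_elim
    case (elim z)
    have "0 \<le> sbregman_batch \<omega>t gt m (prox x) (Y z) (\<lambda>i. z (k, i))"
      unfolding sbregman_batch_def using elim by (intro mult_nonneg_nonneg sum_nonneg sD_nonneg) auto
    moreover have "(1 / t - \<rho>) * sbregman_batch \<omega>t gt m (prox x) (Y z) (\<lambda>i. z (k, i)) \<le> ?h z"
      using elim by (intro batch_step_gap[OF _ _ _ _ prox_dom t(1) a]) auto
    ultimately show ?case using t\<rho> by simp
  qed
  note AE0 = this
  have AE1: "AE z in ?R. ennreal ((1 / t - \<rho>) * sbregman_batch \<omega>t gt m (prox x) (Y z) (\<lambda>i. z (k, i))) \<le> ennreal (?h z)"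
    using AE0 by eventually_elim (rule ennreal_leI, blast)
  have AE2: "AE z in ?R. 0 \<le> ?h z"
    using AE0 by eventually_elim linarith
  have hi: "integrable ?R (\<lambda>z. step_gap t x (prox x) (z (k, i)))"
    and he: "(LINT z|?R. step_gap t x (prox x) (z (k, i))) = (LINT \<xi>|P. step_gap t x (prox x) \<xi>)" if "i < m" for i
  proof -
    have d: "distr ?R P (\<lambda>z. z (k, i)) = P"
      using that by (intro distr_PiM_component prob_space_axioms) auto
    have ms: "(\<lambda>z. z (k, i)) \<in> measurable ?R P" using that by (intro measurable_component_singleton) auto
    have mg: "step_gap t x (prox x) \<in> borel_measurable P" by (rule borel_measurable_integrable) auto
    show "integrable ?R (\<lambda>z. step_gap t x (prox x) (z (k, i)))"
      using integrable_distr_eq[OF ms mg] d by simp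
    show "(LINT z|?R. step_gap t x (prox x) (z (k, i))) = (LINT \<xi>|P. step_gap t x (prox x) \<xi>)"
      using integral_distr[OF ms mg] d by simp
  qed
  have int: "integrable ?R ?h" using hi by (intro integrable_mult_right Bochner_Integration.integrable_sum) auto
  have "(LINT z|?R. ?h z) = (1 / real m) * (\<Sum>i<m. LINT \<xi>|P. step_gap t x (prox x) \<xi>)"
    using hi he by (simp add: Bochner_Integration.integral_sum)
  also have "\<dots> \<le> step_bound t x" using integral_step_gap[OF t(1), of x] m by simp
  finally have "(LINT z|?R. ?h z) \<le> step_bound t x" .
  moreover have "(\<integral>\<^sup>+z. ennreal (?h z) \<partial>?R) = ennreal (LINT z|?R. ?h z)"
    using AE2 int by (intro nn_integral_eq_integral)
  ultimately show ?thesis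
    using nn_integral_mono_AE[OF AE1] by (simp add: ennreal_leI order_trans)
qed

end

section \<open>Descent along a run\<close>

locale stochastic_run = stochastic_model P fs fm r \<omega> \<omega>t gt \<rho> \<tau> L lam
  for P :: "'a measure"
    and fs :: "real ^ 'd \<Rightarrow> 'a \<Rightarrow> real" and fm :: "real ^ 'd \<Rightarrow> real ^ 'd \<Rightarrow> 'a \<Rightarrow> real"
    and r :: "real ^ 'd \<Rightarrow> ereal" and \<omega> :: "real ^ 'd \<Rightarrow> real"
    and \<omega>t :: "real ^ 'd \<Rightarrow> 'a \<Rightarrow> real" and gt :: "real ^ 'd \<Rightarrow> 'a \<Rightarrow> real ^ 'd"
    and \<rho> \<tau> L lam :: real +
  fixes M :: "'w measure" and \<xi> :: "nat \<Rightarrow> nat \<Rightarrow> 'w \<Rightarrow> 'a" and X :: "nat \<Rightarrow> 'w \<Rightarrow> real ^ 'd"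
    and kbar :: "'w \<Rightarrow> nat" and t :: real and m K :: nat and x0 :: "real ^ 'd" and c :: "nat \<Rightarrow> real"
  assumes run: "method_run P fm r \<omega>t gt (\<lambda>_. t) (\<lambda>_. m) K x0 M \<xi> X kbar"
    and lower: "bregman_lower_bound P (total_obj P fs r) \<omega> \<omega>t gt lam c (\<lambda>_. m) K M \<xi> X"
    and K: "1 \<le> K" and x0: "x0 \<in> edom r" and t_less: "t < 1 / \<rho>"
begin

sublocale run: prob_space M
  using run by (simp add: method_run_def)

section \<open>Sample coordinates and the sigma-algebras of the past\<close>

abbreviation "I k \<equiv> sample_index (\<lambda>_. m) k"
abbreviation "Smp k \<equiv> samples (\<lambda>_. m) \<xi> k"
abbreviation "Past k \<equiv> past P M (\<lambda>_. m) \<xi> k"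

lemma t_pos: "0 < t" and m_pos: "0 < m"
  using run K unfolding method_run_def by force+

lemma I_Suc: "I (Suc k) = I k \<union> {k} \<times> {..<m}"
  by (auto simp: sample_index_def less_Suc_eq)

lemma I_disjoint: "I k \<inter> {k} \<times> {..<m} = {}"
  by (auto simp: sample_index_def)

lemma finite_I [simp, intro]: "finite (I k)"
  by (auto simp: sample_index_def)

lemma I_mono: "k \<le> l \<Longrightarrow> I k \<subseteq> I l"
  by (auto simp: sample_index_def)

lemma indep_samples: "run.indep_vars (\<lambda>_. P) (\<lambda>(j, i). \<xi> j i) (I K)"
  using run by (simp add: method_run_def)

lemma measurable_xi: "j < K \<Longrightarrow> i < m \<Longrightarrow> \<xi> j i \<in> measurable M P"
  using indep_samples unfolding run.indep_vars_def by (force simp: sample_index_def)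

lemma measurable_Smp: "k \<le> K \<Longrightarrow> Smp k \<in> measurable M (Pi\<^sub>M (I k) (\<lambda>_. P))"
  unfolding samples_def
  by (rule measurable_restrict) (auto simp: sample_index_def intro!: measurable_xi)

text \<open>Independence and the common law as one product measure. The index \<open>Suc k\<close>
  makes the index set nonempty, as the product characterization of independence requires.\<close>

lemma distr_Smp:
  assumes k: "k < K"
  shows "distr M (Pi\<^sub>M (I (Suc k)) (\<lambda>_. P)) (Smp (Suc k)) = Pi\<^sub>M (I (Suc k)) (\<lambda>_. P)"
proof -
  have ne: "I (Suc k) \<noteq> {}" using m_pos by (auto simp: I_Suc)
  have sub: "I (Suc k) \<subseteq> I K" using k by (intro I_mono) simp
  have rv: "(\<lambda>(j, i). \<xi> j i) p \<in> measurable M P" if "p \<in> I (Suc k)" for p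
    using that k by (auto simp: sample_index_def intro!: measurable_xi)
  have "run.indep_vars (\<lambda>_. P) (\<lambda>(j, i). \<xi> j i) (I (Suc k))"
    using indep_samples sub by (rule run.indep_vars_subset)
  then have "distr M (Pi\<^sub>M (I (Suc k)) (\<lambda>_. P)) (\<lambda>w. \<lambda>p\<in>I (Suc k). (\<lambda>(j, i). \<xi> j i) p w)
    = Pi\<^sub>M (I (Suc k)) (\<lambda>p. distr M P ((\<lambda>(j, i). \<xi> j i) p))"
    by (subst (asm) run.indep_vars_iff_distr_eq_PiM'[OF ne rv])
  also have "\<dots> = Pi\<^sub>M (I (Suc k)) (\<lambda>_. P)"
    using run k unfolding method_run_def by (intro PiM_cong) (auto simp: sample_index_def)
  also have "(\<lambda>w. \<lambda>p\<in>I (Suc k). (\<lambda>(j, i). \<xi> j i) p w) = Smp (Suc k)"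
    by (auto simp: samples_def fun_eq_iff)
  finally show ?thesis .
qed

lemma space_Past: "space (Past k) = space M"
  by (simp add: past_def)

lemma subalgebra_Past: "k \<le> K \<Longrightarrow> subalgebra M (Past k)"
  unfolding subalgebra_def past_def by (auto dest!: sets_image_in_sets[OF refl measurable_Smp])

lemma measurable_X_Past: "k \<le> K \<Longrightarrow> X k \<in> borel_measurable (Past k)"
proof (cases k)
  case 0
  have "X 0 \<in> borel_measurable (Past 0) \<longleftrightarrow> (\<lambda>_. x0) \<in> borel_measurable (Past 0)"
    using run by (intro measurable_cong) (simp add: method_run_def space_Past)
  then show ?thesis using 0 by simp
next
  case (Suc l)
  assume "k \<le> K" then show ?thesis using run Suc by (simp add: method_run_def)
qed

lemma measurable_X: "k \<le> K \<Longrightarrow> X k \<in> borel_measurable M"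
  using measurable_from_subalg[OF subalgebra_Past measurable_X_Past] .

text \<open>Makes the iterates functions on the product space of the samples, where the past and the
  fresh batch are separate coordinates.\<close>

lemma X_factor:
  assumes "k \<le> K"
  obtains \<eta> where "\<eta> \<in> borel_measurable (Pi\<^sub>M (I k) (\<lambda>_. P))" "\<And>w. w \<in> space M \<Longrightarrow> X k w = \<eta> (Smp k w)"
proof -
  have "Smp k \<in> space M \<rightarrow> space (Pi\<^sub>M (I k) (\<lambda>_. P))"
    using measurable_Smp[OF assms] by (auto simp: measurable_def)
  then show ?thesis
    using borel_measurable_vimage_algebra_factor[OF _ measurable_X_Past[OF assms, unfolded past_def]] that
    by blast
qed

lemma AE_argmin: "k < K \<Longrightarrow> AE w in M. X (Suc k) w \<in> dom_r \<and>
  (\<forall>y\<in>dom_r. obj t m (X k w) (\<lambda>i. \<xi> k i w) (X (Suc k) w) \<le> obj t m (X k w) (\<lambda>i. \<xi> k i w) y)"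
proof -
  assume "k < K"
  then have "AE w in M. is_arg_min (batch_obj fm r \<omega>t gt t m (X k w) (\<lambda>i. \<xi> k i w)) (\<lambda>_. True) (X (Suc k) w)"
    using run by (simp add: method_run_def)
  then show ?thesis
  proof eventually_elim
    case (elim w)
    then have *: "batch_obj fm r \<omega>t gt t m (X k w) (\<lambda>i. \<xi> k i w) (X (Suc k) w)
      \<le> batch_obj fm r \<omega>t gt t m (X k w) (\<lambda>i. \<xi> k i w) y" for y
      by (auto simp: is_arg_min_def not_less)
    obtain y0 where "y0 \<in> dom_r" using dom_r_nonempty by blast
    then have dom: "X (Suc k) w \<in> dom_r" using *[of y0] unfolding batch_obj_eq[OF m_pos] by (auto split: if_splits)
    have "obj t m (X k w) (\<lambda>i. \<xi> k i w) (X (Suc k) w) \<le> obj t m (X k w) (\<lambda>i. \<xi> k i w) y" if "y \<in> dom_r" for y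
      using *[of y] that dom unfolding batch_obj_eq[OF m_pos] by simp
    with dom show ?case by blast
  qed
qed

lemma AE_X_dom: "k \<le> K \<Longrightarrow> AE w in M. X k w \<in> dom_r"
proof (cases k)
  case 0
  then show ?thesis using run x0 by (auto simp: method_run_def intro!: AE_I2)
next
  case (Suc l)
  assume "k \<le> K"
  with Suc show ?thesis using AE_argmin[of l] by (auto elim!: eventually_mono)
qed

lemma restrict_Smp: "k \<le> l \<Longrightarrow> restrict (Smp l w) (I k) = Smp k w"
  using I_mono[of k l] by (auto simp: samples_def fun_eq_iff restrict_def)

lemma subalgebra_Past_mono:
  assumes "k \<le> l" "l \<le> K"
  shows "subalgebra (Past l) (Past k)"
proof -
  have "Smp l \<in> measurable (Past l) (Pi\<^sub>M (I l) (\<lambda>_. P))"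
    unfolding past_def using measurable_Smp[OF assms(2)]
    by (intro measurable_vimage_algebra1) (auto simp: measurable_def)
  then have "(\<lambda>w. restrict (Smp l w) (I k)) \<in> measurable (Past l) (Pi\<^sub>M (I k) (\<lambda>_. P))"
    by (rule measurable_compose) (rule measurable_restrict_subset[OF I_mono[OF assms(1)]])
  then have "Smp k \<in> measurable (Past l) (Pi\<^sub>M (I k) (\<lambda>_. P))"
    by (simp add: restrict_Smp[OF assms(1)])
  from sets_image_in_sets[OF _ this, of "space M"] show ?thesis
    by (simp add: subalgebra_def space_Past) (simp add: past_def)
qed

text \<open>Conditionally on the past the point \<open>X k\<close> is fixed; Fubini on the sample space then reduces the
  step to \<open>nn_integral_batch_le\<close>. Minimality is needed only against the points
  \<open>X (k + 1) + (prox (X k) - X (k + 1)) / (n + 2)\<close>, which keeps the exceptional set measurable.\<close>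

lemma nn_integral_step:
  assumes k: "k < K"
  shows "(\<integral>\<^sup>+w. ennreal ((1 / t - \<rho>) * sbregman_batch \<omega>t gt m (prox (X k w)) (X (Suc k) w) (\<lambda>i. \<xi> k i w)) \<partial>M)
    \<le> (\<integral>\<^sup>+w. ennreal (step_bound t (X k w)) \<partial>M)"
proof -
  let ?I = "I k" and ?J = "{k} \<times> {..<m}" and ?S = "I (Suc k)"
  let ?PI = "Pi\<^sub>M ?I (\<lambda>_. P)" and ?PJ = "Pi\<^sub>M ?J (\<lambda>_. P)" and ?PS = "Pi\<^sub>M ?S (\<lambda>_. P)"
  obtain \<eta> where \<eta> [measurable]: "\<eta> \<in> borel_measurable ?PI" and X\<eta>: "\<And>w. w \<in> space M \<Longrightarrow> X k w = \<eta> (Smp k w)"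
    using X_factor[of k] k by auto
  obtain \<Psi> where \<Psi> [measurable]: "\<Psi> \<in> borel_measurable ?PS"
    and X\<Psi>: "\<And>w. w \<in> space M \<Longrightarrow> X (Suc k) w = \<Psi> (Smp (Suc k) w)"
    using X_factor[of "Suc k"] k by auto
  define a where "a n = 1 / real (n + 2)" for n
  have a: "0 < a n" "a n \<le> 1" for n by (auto simp: a_def)
  have a0: "a \<longlonglongrightarrow> 0" unfolding a_def by real_asymp
  \<comment> \<open>The base point of the step as a function of all samples so far, reading only
    those of the past.\<close>
  define x where "x z = \<eta> (restrict z ?I)" for z
  have res [measurable]: "(\<lambda>z. restrict z ?I) \<in> measurable ?PS ?PI"
    by (rule measurable_restrict_subset) (rule I_mono, simp)
  have x [measurable]: "x \<in> borel_measurable ?PS" unfolding x_def by measurable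
  have comp [measurable]: "(\<lambda>z. z (k, i)) \<in> measurable ?PS P" if "i < m" for i
    using that by (intro measurable_component_singleton) (simp add: I_Suc)
  have Sm: "Smp (Suc k) \<in> measurable M ?PS" using k by (intro measurable_Smp) simp
  have obj_meas: "(\<lambda>z. obj t m (x z) (\<lambda>i. z (k, i)) (y z)) \<in> borel_measurable ?PS"
    if [measurable]: "y \<in> borel_measurable ?PS" for y
    unfolding obj_def
    by (intro borel_measurable_times borel_measurable_sum borel_measurable_add borel_measurable_const
        measurable_fm measurable_sD measurable_compose[OF _ measurable_r_real] x comp that) auto
  define ok where "ok z \<longleftrightarrow> x z \<in> dom_r \<and> \<Psi> z \<in> dom_r \<and>
      (\<forall>n. obj t m (x z) (\<lambda>i. z (k, i)) (\<Psi> z)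
        \<le> obj t m (x z) (\<lambda>i. z (k, i)) (\<Psi> z + a n *\<^sub>R (prox (x z) - \<Psi> z)))" for z
  have ok_meas: "{z \<in> space ?PS. ok z} \<in> sets ?PS"
  proof -
    define u where "u z = obj t m (x z) (\<lambda>i. z (k, i)) (\<Psi> z)" for z
    define v where "v n z = obj t m (x z) (\<lambda>i. z (k, i)) (\<Psi> z + a n *\<^sub>R (prox (x z) - \<Psi> z))" for n z
    have "u \<in> borel_measurable ?PS" "v n \<in> borel_measurable ?PS" for n
      unfolding u_def v_def by (intro obj_meas; measurable)+
    then have [measurable]: "Measurable.pred ?PS (\<lambda>z. u z \<le> v n z)" for n
      unfolding pred_def by (intro borel_measurable_le)
    show ?thesis unfolding ok_def u_def[symmetric] v_def[symmetric] by measurable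
  qed
  have "AE w in M. ok (Smp (Suc k) w)"
    using AE_argmin[OF k] AE_X_dom[OF less_imp_le[OF k]] AE_space
  proof eventually_elim
    case (elim w)
    have xw: "x (Smp (Suc k) w) = X k w" and \<Psi>w: "\<Psi> (Smp (Suc k) w) = X (Suc k) w"
      and B: "i < m \<Longrightarrow> Smp (Suc k) w (k, i) = \<xi> k i w" for i
      using elim X\<eta> X\<Psi> by (simp_all add: x_def restrict_Smp) (simp add: samples_def I_Suc)
    have o: "obj t m (X k w) (\<lambda>i. Smp (Suc k) w (k, i)) y = obj t m (X k w) (\<lambda>i. \<xi> k i w) y" for y
      unfolding obj_def using B by simp
    have "X (Suc k) w + a n *\<^sub>R (prox (X k w) - X (Suc k) w) \<in> dom_r" for n
    proof -
      have "X (Suc k) w + a n *\<^sub>R (prox (X k w) - X (Suc k) w) = (1 - a n) *\<^sub>R X (Suc k) w + a n *\<^sub>R prox (X k w)"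
        by (simp add: algebra_simps)
      then show ?thesis using convexD[OF convex_dom_r _ prox_dom, of "X (Suc k) w" "1 - a n" "a n"] elim a[of n] by simp
    qed
    then show ?case unfolding ok_def xw \<Psi>w o using elim by auto
  qed
  then have "AE z in distr M ?PS (Smp (Suc k)). ok z"
    by (subst AE_distr_iff[OF Sm ok_meas])
  then have okS: "AE z in ?PS. ok z" by (subst (asm) distr_Smp[OF k])
  interpret PP: product_prob_space "\<lambda>_. P" ?S by standard
  interpret PI: prob_space ?PI by (intro prob_space_PiM) (rule prob_space_axioms)
  interpret PJ: prob_space ?PJ by (intro prob_space_PiM) (rule prob_space_axioms)
  interpret pair: pair_sigma_finite ?PI ?PJ ..
  have mg: "merge ?I ?J \<in> measurable (?PI \<Otimes>\<^sub>M ?PJ) ?PS"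
    unfolding I_Suc by (rule measurable_merge)
  have dm: "distr (?PI \<Otimes>\<^sub>M ?PJ) ?PS (merge ?I ?J) = ?PS"
    unfolding I_Suc by (rule PP.distr_merge[OF I_disjoint]) auto
  have "AE p in ?PI \<Otimes>\<^sub>M ?PJ. ok (merge ?I ?J p)"
    using okS by (subst (asm) dm[symmetric]) (simp add: AE_distr_iff[OF mg ok_meas])
  \<comment> \<open>For almost every fixed past \<open>s\<close>, a statement about the fresh batch
    alone.\<close>
  then have okI: "AE s in ?PI. AE z in ?PJ. ok (merge ?I ?J (s, z))" by (rule pair.AE_pair)
  have fold: "(\<integral>\<^sup>+w. f (Smp (Suc k) w) \<partial>M) = (\<integral>\<^sup>+s. \<integral>\<^sup>+z. f (merge ?I ?J (s, z)) \<partial>?PJ \<partial>?PI)"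
    if f: "f \<in> borel_measurable ?PS" for f :: "(nat \<times> nat \<Rightarrow> 'a) \<Rightarrow> ennreal"
  proof -
    have "(\<integral>\<^sup>+w. f (Smp (Suc k) w) \<partial>M) = (\<integral>\<^sup>+z. f z \<partial>distr M ?PS (Smp (Suc k)))"
      by (rule nn_integral_distr[symmetric]) (use Sm f in auto)
    also have "\<dots> = (\<integral>\<^sup>+z. f z \<partial>?PS)" by (simp only: distr_Smp[OF k])
    also have "\<dots> = (\<integral>\<^sup>+s. \<integral>\<^sup>+z. f (merge ?I ?J (s, z)) \<partial>?PJ \<partial>?PI)"
      using f unfolding I_Suc by (intro PP.product_nn_integral_fold[OF I_disjoint]) auto
    finally show ?thesis .
  qed
  define g where "g z = ennreal ((1 / t - \<rho>) * sbregman_batch \<omega>t gt m (prox (x z)) (\<Psi> z) (\<lambda>i. z (k, i)))" for z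
  have g: "g \<in> borel_measurable ?PS" unfolding g_def sbregman_batch_def
    by (intro measurable_compose[OF _ measurable_ennreal] borel_measurable_times borel_measurable_sum
        borel_measurable_const measurable_sD measurable_compose[OF x measurable_prox] \<Psi> comp) auto
  define h where "h z = ennreal (step_bound t (x z))" for z
  have h: "h \<in> borel_measurable ?PS" unfolding h_def step_bound_def by measurable
  have "(\<integral>\<^sup>+w. ennreal ((1 / t - \<rho>) * sbregman_batch \<omega>t gt m (prox (X k w)) (X (Suc k) w) (\<lambda>i. \<xi> k i w)) \<partial>M)
    = (\<integral>\<^sup>+w. g (Smp (Suc k) w) \<partial>M)"
    by (rule nn_integral_cong)
       (simp add: g_def x_def restrict_Smp X\<eta> X\<Psi> sbregman_batch_def samples_def I_Suc)
  also have "\<dots> = (\<integral>\<^sup>+s. \<integral>\<^sup>+z. g (merge ?I ?J (s, z)) \<partial>?PJ \<partial>?PI)" by (rule fold[OF g])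
  also have "\<dots> \<le> (\<integral>\<^sup>+s. \<integral>\<^sup>+z. h (merge ?I ?J (s, z)) \<partial>?PJ \<partial>?PI)"
  proof (rule nn_integral_mono_AE)
    show "AE s in ?PI. (\<integral>\<^sup>+z. g (merge ?I ?J (s, z)) \<partial>?PJ) \<le> (\<integral>\<^sup>+z. h (merge ?I ?J (s, z)) \<partial>?PJ)"
      using okI AE_space
    proof eventually_elim
      case (elim s)
      have xs: "x (merge ?I ?J (s, z)) = \<eta> s" for z
      proof -
        have "restrict (merge ?I ?J (s, z)) ?I = restrict s ?I" by (auto simp: merge_def)
        also have "\<dots> = s" using elim(2) by (auto simp: space_PiM PiE_restrict)
        finally show ?thesis by (simp add: x_def)
      qed
      have B: "merge ?I ?J (s, z) (k, i) = z (k, i)" if "i < m" for z i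
        using that by (simp add: merge_def sample_index_def)
      have o: "obj t m y (\<lambda>i. merge ?I ?J (s, z) (k, i)) q = obj t m y (\<lambda>i. z (k, i)) q" for y q z
        unfolding obj_def using B by simp
      have b: "sbregman_batch \<omega>t gt m y q (\<lambda>i. merge ?I ?J (s, z) (k, i)) = sbregman_batch \<omega>t gt m y q (\<lambda>i. z (k, i))" for y q z
        unfolding sbregman_batch_def using B by simp
      have ok': "AE z in ?PJ. \<eta> s \<in> dom_r \<and> \<Psi> (merge ?I ?J (s, z)) \<in> dom_r \<and>
        (\<forall>n. obj t m (\<eta> s) (\<lambda>i. z (k, i)) (\<Psi> (merge ?I ?J (s, z)))
          \<le> obj t m (\<eta> s) (\<lambda>i. z (k, i)) (\<Psi> (merge ?I ?J (s, z)) + a n *\<^sub>R (prox (\<eta> s) - \<Psi> (merge ?I ?J (s, z)))))"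
        using elim(1) unfolding ok_def xs o .
      \<comment> \<open>The statement does not depend on \<open>z\<close>, so on a probability space
        it holds outright.\<close>
      then have "AE z in ?PJ. \<eta> s \<in> dom_r" by (auto elim!: eventually_mono)
      then have dom: "\<eta> s \<in> dom_r" by simp
      have "(\<integral>\<^sup>+z. g (merge ?I ?J (s, z)) \<partial>?PJ) \<le> ennreal (step_bound t (\<eta> s))"
        unfolding g_def xs b
        by (rule nn_integral_batch_le[OF dom t_pos t_less m_pos a0 a]) (use ok' in \<open>auto elim!: eventually_mono\<close>)
      also have "\<dots> = (\<integral>\<^sup>+z. h (merge ?I ?J (s, z)) \<partial>?PJ)"
        unfolding h_def xs by (simp add: PJ.emeasure_space_1)
      finally show ?case .
    qed
  qed
  also have "\<dots> = (\<integral>\<^sup>+w. h (Smp (Suc k) w) \<partial>M)" by (rule fold[OF h, symmetric])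
  also have "\<dots> = (\<integral>\<^sup>+w. ennreal (step_bound t (X k w)) \<partial>M)"
    by (rule nn_integral_cong) (simp add: h_def x_def restrict_Smp X\<eta>)
  finally show ?thesis .
qed

text \<open>Integrating the conditional inequality removes the conditioning, since
  \<open>nn_cond_exp\<close> preserves the total integral.\<close>

lemma nn_integral_lower:
  assumes k: "k < K"
  shows "ennreal (c m) * (\<integral>\<^sup>+w. ennreal (Dw (prox (X k w)) (X (Suc k) w)) \<partial>M)
    \<le> (\<integral>\<^sup>+w. ennreal (sbregman_batch \<omega>t gt m (prox (X k w)) (X (Suc k) w) (\<lambda>i. \<xi> k i w)) \<partial>M)"
proof -
  let ?f = "\<lambda>w. ennreal (Dw (prox (X k w)) (X (Suc k) w))"
  let ?g = "\<lambda>w. ennreal (sbregman_batch \<omega>t gt m (prox (X k w)) (X (Suc k) w) (\<lambda>i. \<xi> k i w))"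
  interpret sub: finite_measure_subalgebra M "Past k"
    using k by unfold_locales (auto intro: subalgebra_Past)
  have X [measurable]: "X k \<in> borel_measurable M" "X (Suc k) \<in> borel_measurable M"
    using k by (auto intro: measurable_X)
  have f: "?f \<in> borel_measurable M" by measurable
  have g: "?g \<in> borel_measurable M" unfolding sbregman_batch_def
    by (intro measurable_compose[OF _ measurable_ennreal] borel_measurable_times borel_measurable_sum
        borel_measurable_const measurable_sD measurable_compose[OF X(1) measurable_prox] X measurable_xi k) auto
  have int: "(\<integral>\<^sup>+w. nn_cond_exp M (Past k) q w \<partial>M) = (\<integral>\<^sup>+w. q w \<partial>M)" if "q \<in> borel_measurable M" for q
    using sub.nn_cond_exp_intg[OF _ that, of "\<lambda>_. 1"] by simp
  have "ennreal (c m) * (\<integral>\<^sup>+w. ?f w \<partial>M) = (\<integral>\<^sup>+w. ennreal (c m) * nn_cond_exp M (Past k) ?f w \<partial>M)"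
    by (simp add: nn_integral_cmult int[OF f])
  also have "\<dots> \<le> (\<integral>\<^sup>+w. nn_cond_exp M (Past k) ?g w \<partial>M)"
    using lower k unfolding bregman_lower_bound_def by (intro nn_integral_mono_AE) auto
  also have "\<dots> = (\<integral>\<^sup>+w. ?g w \<partial>M)" by (rule int[OF g])
  finally show ?thesis .
qed

section \<open>Constants and expected descent of the envelope\<close>

definition \<kappa> :: real where "\<kappa> = t / (lam * c m * (1 - t * \<rho>))"
definition rate :: real where
  "rate = (1 / c m) * (t * (1 - lam * (\<rho> + \<tau>)) / (1 - t * \<rho>) - lam * (1 - c m))"
definition noise :: real where "noise = t\<^sup>2 * L\<^sup>2 / (4 * lam * c m * (1 - t * \<rho>))"
abbreviation "Dsym x \<equiv> bregman_sym \<omega> lam (prox x) x"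

lemma c_pos: "0 < c m" and c_le: "c m \<le> 1"
  using lower by (auto simp: bregman_lower_bound_def)

lemma trho: "0 < 1 - t * \<rho>" "0 < 1 / t - \<rho>"
  using t_less t_pos rho_pos by (simp_all add: field_simps)

lemma \<kappa>_pos: "0 < \<kappa>"
  using t_pos lam_pos c_pos trho by (simp add: \<kappa>_def)

text \<open>The defining property of \<kappa>: after scaling, the factor \<open>c m\<close> from the
  lower bound cancels and \<open>1 / lam\<close>, the weight in the envelope, is left.\<close>

lemma \<kappa>_eq: "\<kappa> * (1 / t - \<rho>) = 1 / (lam * c m)"
  using t_pos lam_pos c_pos trho by (simp add: \<kappa>_def field_simps)

lemma \<kappa>_noise: "\<kappa> * (t / 4 * L\<^sup>2) = noise"
  by (simp add: \<kappa>_def noise_def power2_eq_square ac_simps)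

text \<open>The first term is the gain from relative strong convexity, the second the loss due to
  \<open>c m < 1\<close>.\<close>

lemma rate_eq: "rate / lam\<^sup>2 = \<kappa> * \<beta> - (1 - c m) / (c m * lam)"
proof -
  have *: "1 - lam * (\<rho> + \<tau>) = lam * \<beta>" using lam_pos by (simp add: \<beta>_def field_simps)
  show ?thesis
    using lam_pos c_pos trho(1) unfolding rate_def \<kappa>_def *
    by (simp add: field_simps power2_eq_square)
qed

lemma noise_nonneg: "0 \<le> noise"
  using lam_pos c_pos trho by (simp add: noise_def)

lemma Dsym_nonneg: "0 \<le> Dsym x"
  using Dw_nonneg by (simp add: bregman_sym_def)

lemma measurable_Dsym [measurable]: "(\<lambda>x. Dsym x) \<in> borel_measurable borel"
  unfolding bregman_sym_def by measurable

text \<open>\<open>ennreal\<close> truncates negative reals to zero, so the step bounds can be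
  combined with the other terms only once they are known to be nonnegative. The Lipschitz estimate
  with weight \<open>t / 2\<close> provides this.\<close>

lemma step_bound_nonneg: "x \<in> dom_r \<Longrightarrow> 0 \<le> step_bound t x"
  using F_real_lip[of x "prox x" "t / 2"] prox_dom t_pos by (simp add: step_bound_def distrib_right)

lemma one_step_algebra:
  assumes x: "x \<in> dom_r"
  shows "F_real (prox x) - Finf + \<kappa> * step_bound t x + rate * Dsym x \<le> env x - Finf + noise"
proof -
  let ?A = "Dw (prox x) x" and ?B = "Dw x (prox x)"
  have env: "env x = F_real (prox x) + ?A / lam" by (simp add: env_def psi_def)
  have "env x + \<beta> * ?B \<le> F_real x"
    using prox_three_point[OF x, of x] by (simp add: env_def psi_def[of x x] bregman_def[of \<omega> x x])
  then have "step_bound t x \<le> (\<tau> + 1 / t - 1 / lam) * ?A - \<beta> * ?B + t / 4 * L\<^sup>2"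
    unfolding step_bound_def env by (simp add: algebra_simps)
  then have "\<kappa> * step_bound t x \<le> \<kappa> * ((\<tau> + 1 / t - 1 / lam) * ?A - \<beta> * ?B + t / 4 * L\<^sup>2)"
    using \<kappa>_pos by (simp add: mult_left_mono)
  \<comment> \<open>By definition of \<beta>, \<open>\<tau> + 1 / t - 1 / lam\<close> equals
    \<open>(1 / t - \<rho>) - \<beta>\<close>, so \<open>?A\<close> and \<open>?B\<close> share the
    coefficient with \<beta>.\<close>
  also have "\<dots> = \<kappa> * (1 / t - \<rho>) * ?A - \<kappa> * \<beta> * (?A + ?B) + noise"
    unfolding \<kappa>_noise[symmetric] \<beta>_def by (simp add: algebra_simps)
  also have "\<dots> = 1 / (lam * c m) * ?A - \<kappa> * \<beta> * (?A + ?B) + noise" by (simp only: \<kappa>_eq)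
  finally have 1: "\<kappa> * step_bound t x \<le> 1 / (lam * c m) * ?A - \<kappa> * \<beta> * (?A + ?B) + noise" .
  have "rate * Dsym x = (rate / lam\<^sup>2) * (?A + ?B)" by (simp add: bregman_sym_def)
  also have "\<dots> = \<kappa> * \<beta> * (?A + ?B) - (1 - c m) / (c m * lam) * (?A + ?B)"
    unfolding rate_eq by (simp add: left_diff_distrib)
  \<comment> \<open>The loss is needed against \<open>?A\<close> only; its \<open>?B\<close> part is
    nonnegative and is dropped.\<close>
  also have "\<dots> \<le> \<kappa> * \<beta> * (?A + ?B) - (1 - c m) / (c m * lam) * ?A"
  proof -
    have "0 \<le> (1 - c m) / (c m * lam) * ?B" using c_pos c_le lam_pos Dw_nonneg by simp
    then show ?thesis by (simp add: distrib_left)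
  qed
  finally have 2: "rate * Dsym x \<le> \<kappa> * \<beta> * (?A + ?B) - (1 - c m) / (c m * lam) * ?A" .
  have "1 / (lam * c m) * ?A - (1 - c m) / (c m * lam) * ?A = ?A / lam"
    using c_pos lam_pos by (simp add: field_simps)
  with 1 2 show ?thesis unfolding env by linarith
qed

text \<open>The distance term stands on the left, since subtraction is unsafe while the integrals
  may be infinite. Subtracting \<open>Finf\<close> makes the envelope terms nonnegative.\<close>

lemma nn_integral_descent:
  assumes k: "k < K" and rate: "0 \<le> rate"
  shows "(\<integral>\<^sup>+w. ennreal (env (X (Suc k) w) - Finf) \<partial>M) + (\<integral>\<^sup>+w. ennreal (rate * Dsym (X k w)) \<partial>M)
    \<le> (\<integral>\<^sup>+w. ennreal (env (X k w) - Finf) \<partial>M) + ennreal noise"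
proof -
  have X [measurable]: "X k \<in> borel_measurable M" "X (Suc k) \<in> borel_measurable M"
    using k by (auto intro: measurable_X)
  let ?x = "X k" and ?y = "X (Suc k)"
  let ?b = "\<lambda>w. sbregman_batch \<omega>t gt m (prox (?x w)) (?y w) (\<lambda>i. \<xi> k i w)"
  have [measurable]: "(\<lambda>w. step_bound t (?x w)) \<in> borel_measurable M"
    unfolding step_bound_def by measurable
  have bm: "(\<lambda>w. ennreal (?b w)) \<in> borel_measurable M" unfolding sbregman_batch_def
    by (intro measurable_compose[OF _ measurable_ennreal] borel_measurable_times borel_measurable_sum
        borel_measurable_const measurable_sD measurable_compose[OF X(1) measurable_prox] X measurable_xi k) auto
  have "(\<integral>\<^sup>+w. ennreal (Dw (prox (?x w)) (?y w) / lam) \<partial>M)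
    = (\<integral>\<^sup>+w. ennreal (\<kappa> * (1 / t - \<rho>)) * (ennreal (c m) * ennreal (Dw (prox (?x w)) (?y w))) \<partial>M)"
    unfolding \<kappa>_eq using lam_pos c_pos
    by (intro nn_integral_cong) (simp add: ennreal_mult'[symmetric] Dw_nonneg)
  also have "\<dots> = ennreal (\<kappa> * (1 / t - \<rho>)) * (ennreal (c m) * (\<integral>\<^sup>+w. ennreal (Dw (prox (?x w)) (?y w)) \<partial>M))"
    by (simp add: nn_integral_cmult)
  also have "\<dots> \<le> ennreal (\<kappa> * (1 / t - \<rho>)) * (\<integral>\<^sup>+w. ennreal (?b w) \<partial>M)"
    by (intro mult_left_mono nn_integral_lower[OF k]) simp
  also have "\<dots> = ennreal \<kappa> * (\<integral>\<^sup>+w. ennreal ((1 / t - \<rho>) * ?b w) \<partial>M)"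
    using \<kappa>_pos trho by (simp add: ennreal_mult' nn_integral_cmult bm mult.assoc)
  also have "\<dots> \<le> ennreal \<kappa> * (\<integral>\<^sup>+w. ennreal (step_bound t (?x w)) \<partial>M)"
    by (intro mult_left_mono nn_integral_step[OF k]) simp
  also have "\<dots> = (\<integral>\<^sup>+w. ennreal (\<kappa> * step_bound t (?x w)) \<partial>M)"
    using \<kappa>_pos by (simp add: ennreal_mult' nn_integral_cmult)
  finally have D: "(\<integral>\<^sup>+w. ennreal (Dw (prox (?x w)) (?y w) / lam) \<partial>M)
    \<le> (\<integral>\<^sup>+w. ennreal (\<kappa> * step_bound t (?x w)) \<partial>M)" .
  have "(\<integral>\<^sup>+w. ennreal (env (?y w) - Finf) \<partial>M)
    \<le> (\<integral>\<^sup>+w. ennreal (F_real (prox (?x w)) - Finf) + ennreal (Dw (prox (?x w)) (?y w) / lam) \<partial>M)"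
  proof (rule nn_integral_mono)
    fix w
    have "env (?y w) \<le> F_real (prox (?x w)) + Dw (prox (?x w)) (?y w) / lam"
      using prox_min[OF prox_dom, of "?y w" "?x w"] by (simp add: env_def psi_def)
    then show "ennreal (env (?y w) - Finf) \<le> ennreal (F_real (prox (?x w)) - Finf) + ennreal (Dw (prox (?x w)) (?y w) / lam)"
      using Finf_le[OF prox_dom] Dw_nonneg lam_pos
      by (subst ennreal_plus[symmetric]) (auto intro!: ennreal_leI simp del: ennreal_plus)
  qed
  also have "\<dots> = (\<integral>\<^sup>+w. ennreal (F_real (prox (?x w)) - Finf) \<partial>M) + (\<integral>\<^sup>+w. ennreal (Dw (prox (?x w)) (?y w) / lam) \<partial>M)"
    by (rule nn_integral_add) measurable
  also have "\<dots> \<le> (\<integral>\<^sup>+w. ennreal (F_real (prox (?x w)) - Finf) \<partial>M) + (\<integral>\<^sup>+w. ennreal (\<kappa> * step_bound t (?x w)) \<partial>M)"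
    using D by (rule add_left_mono)
  finally have "(\<integral>\<^sup>+w. ennreal (env (?y w) - Finf) \<partial>M) + (\<integral>\<^sup>+w. ennreal (rate * Dsym (?x w)) \<partial>M)
    \<le> (\<integral>\<^sup>+w. ennreal (F_real (prox (?x w)) - Finf) \<partial>M) + (\<integral>\<^sup>+w. ennreal (\<kappa> * step_bound t (?x w)) \<partial>M)
      + (\<integral>\<^sup>+w. ennreal (rate * Dsym (?x w)) \<partial>M)"
    by (rule add_right_mono)
  also have "\<dots> = (\<integral>\<^sup>+w. ennreal (F_real (prox (?x w)) - Finf) + ennreal (\<kappa> * step_bound t (?x w)) + ennreal (rate * Dsym (?x w)) \<partial>M)"
    by (simp add: nn_integral_add)
  also have "\<dots> \<le> (\<integral>\<^sup>+w. ennreal (env (?x w) - Finf) + ennreal noise \<partial>M)"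
  proof (rule nn_integral_mono_AE)
    show "AE w in M. ennreal (F_real (prox (?x w)) - Finf) + ennreal (\<kappa> * step_bound t (?x w)) + ennreal (rate * Dsym (?x w))
      \<le> ennreal (env (?x w) - Finf) + ennreal noise"
      using AE_X_dom[OF less_imp_le[OF k]]
    proof eventually_elim
      case (elim w)
      have "0 \<le> F_real (prox (?x w)) - Finf" "0 \<le> \<kappa> * step_bound t (?x w)" "0 \<le> rate * Dsym (?x w)"
        "0 \<le> env (?x w) - Finf"
        using Finf_le[OF prox_dom] step_bound_nonneg[OF elim] \<kappa>_pos rate Dsym_nonneg Finf_le_env by auto
      then show ?case
        using one_step_algebra[OF elim] noise_nonneg by (simp add: ennreal_plus[symmetric] ennreal_leI del: ennreal_plus)
    qed
  qed
  also have "\<dots> = (\<integral>\<^sup>+w. ennreal (env (?x w) - Finf) \<partial>M) + ennreal noise"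
    by (subst nn_integral_add) (auto simp: run.emeasure_space_1)
  finally show ?thesis .
qed

text \<open>\<open>X 0\<close> is the constant \<open>x0\<close>, so the right-hand side is finite,
  and with it every integral on the left.\<close>

lemma nn_integral_telescope:
  assumes rate: "0 \<le> rate" and "n \<le> K"
  shows "(\<integral>\<^sup>+w. ennreal (env (X n w) - Finf) \<partial>M) + (\<Sum>k<n. \<integral>\<^sup>+w. ennreal (rate * Dsym (X k w)) \<partial>M)
    \<le> ennreal (env x0 - Finf) + of_nat n * ennreal noise"
  using assms(2)
proof (induction n)
  case 0
  have "(\<integral>\<^sup>+w. ennreal (env (X 0 w) - Finf) \<partial>M) = (\<integral>\<^sup>+w. ennreal (env x0 - Finf) \<partial>M)"
    using run by (intro nn_integral_cong) (simp add: method_run_def)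
  then show ?case by (simp add: run.emeasure_space_1)
next
  case (Suc n)
  let ?v = "\<lambda>n. \<integral>\<^sup>+w. ennreal (env (X n w) - Finf) \<partial>M" and ?d = "\<lambda>k. \<integral>\<^sup>+w. ennreal (rate * Dsym (X k w)) \<partial>M"
  have "?v (Suc n) + (\<Sum>k<Suc n. ?d k) = (?v (Suc n) + ?d n) + (\<Sum>k<n. ?d k)"
    by (simp add: ac_simps)
  also have "\<dots> \<le> (?v n + ennreal noise) + (\<Sum>k<n. ?d k)"
    using Suc.prems by (intro add_right_mono nn_integral_descent rate) simp
  also have "\<dots> = (?v n + (\<Sum>k<n. ?d k)) + ennreal noise" by (simp add: ac_simps)
  also have "\<dots> \<le> (ennreal (env x0 - Finf) + of_nat n * ennreal noise) + ennreal noise"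
    using Suc by (intro add_right_mono) simp
  finally show ?case by (simp add: distrib_right ac_simps)
qed

text \<open>\<open>kbar\<close> is independent of all samples, hence the integral of the product
  factors; constant positive step sizes give each index probability \<open>1 / K\<close>.\<close>

lemma nn_integral_kbar:
  assumes k: "k < K" and g: "g \<in> borel_measurable (Past K)"
  shows "(\<integral>\<^sup>+w. indicator {k} (kbar w) * g w \<partial>M) = ennreal (1 / real K) * (\<integral>\<^sup>+w. g w \<partial>M)"
proof -
  let ?f = "\<lambda>w. indicator {k} (kbar w) :: ennreal"
  let ?V = "vimage_algebra (space M) kbar (count_space {..<K})"
  have kb [measurable]: "kbar \<in> measurable M (count_space {..<K})"
    using run by (simp add: method_run_def)
  have kV: "kbar \<in> measurable ?V (count_space {..<K})"
    using kb by (intro measurable_vimage_algebra1) (simp add: measurable_def)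
  have fV: "?f \<in> borel_measurable ?V" by (rule measurable_compose[OF kV]) simp
  have f: "?f \<in> borel_measurable M" by (rule measurable_compose[OF kb]) simp
  have gM: "g \<in> borel_measurable M" using measurable_from_subalg[OF subalgebra_Past g] by simp
  have ind: "run.indep_set (sets ?V) (sets (Past K))"
    using run by (simp add: method_run_def)
  have "run.indep_var borel ?f borel g"
    unfolding run.indep_var_eq
  proof (intro conjI f gM run.indep_setI)
    have "{?f -` A \<inter> space M |A. A \<in> sets borel} \<subseteq> sets ?V"
      using measurable_sets[OF fV] by auto
    from sets.sigma_sets_subset[OF this]
    have 1: "sigma_sets (space M) {?f -` A \<inter> space M |A. A \<in> sets borel} \<subseteq> sets ?V" by simp
    have "{g -` A \<inter> space M |A. A \<in> sets borel} \<subseteq> sets (Past K)"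
      using measurable_sets[OF g] by (auto simp: space_Past)
    from sets.sigma_sets_subset[OF this]
    have 2: "sigma_sets (space M) {g -` A \<inter> space M |A. A \<in> sets borel} \<subseteq> sets (Past K)"
      by (simp add: space_Past)
    show "sigma_sets (space M) {?f -` A \<inter> space M |A. A \<in> sets borel} \<subseteq> run.events"
      using 1 run.indep_setD_ev1[OF ind] by blast
    show "sigma_sets (space M) {g -` A \<inter> space M |A. A \<in> sets borel} \<subseteq> run.events"
      using 2 run.indep_setD_ev2[OF ind] by blast
    show "run.prob (a \<inter> b) = run.prob a * run.prob b"
      if "a \<in> sigma_sets (space M) {?f -` A \<inter> space M |A. A \<in> sets borel}"
        "b \<in> sigma_sets (space M) {g -` A \<inter> space M |A. A \<in> sets borel}" for a b
      using run.indep_setD[OF ind] that 1 2 by blast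
  qed
  then have "run.indep_vars (\<lambda>_. borel) (case_bool ?f g) UNIV"
    unfolding run.indep_var_def by (rule run.indep_vars_cong[THEN iffD1, rotated -1]) (auto split: bool.split)
  then have "(\<integral>\<^sup>+w. (\<Prod>i\<in>UNIV. case_bool ?f g i w) \<partial>M) = (\<Prod>i\<in>UNIV. \<integral>\<^sup>+w. case_bool ?f g i w \<partial>M)"
    by (intro run.indep_vars_nn_integral) auto
  then have "(\<integral>\<^sup>+w. ?f w * g w \<partial>M) = (\<integral>\<^sup>+w. ?f w \<partial>M) * (\<integral>\<^sup>+w. g w \<partial>M)"
    by (simp add: UNIV_bool mult.commute)
  also have "(\<integral>\<^sup>+w. ?f w \<partial>M) = (\<integral>\<^sup>+w. indicator {w \<in> space M. kbar w = k} w \<partial>M)"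
    by (intro nn_integral_cong) (auto simp: indicator_def)
  also have "\<dots> = emeasure M {w \<in> space M. kbar w = k}"
  proof (rule nn_integral_indicator)
    have "kbar -` {k} \<inter> space M \<in> sets M" by (rule measurable_sets[OF kb]) (use k in auto)
    moreover have "kbar -` {k} \<inter> space M = {w \<in> space M. kbar w = k}" by auto
    ultimately show "{w \<in> space M. kbar w = k} \<in> sets M" by simp
  qed
  also have "\<dots> = ennreal (1 / real K)"
    using run k t_pos unfolding run.emeasure_eq_measure method_run_def by simp
  finally show ?thesis .
qed

lemma expected_Dsym_bound:
  assumes rate: "0 < rate"
  shows "integrable M (\<lambda>w. Dsym (X (kbar w) w))"
    and "(LINT w|M. Dsym (X (kbar w) w)) \<le> (env x0 - Finf) / (rate * real K) + noise / rate"
proof -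
  let ?D = "\<lambda>w. Dsym (X (kbar w) w)"
  let ?d = "\<lambda>k w. indicator {k} (kbar w) * ennreal (Dsym (X k w))"
  have Kpos: "0 < real K" using K by simp
  have kb [measurable]: "kbar \<in> measurable M (count_space {..<K})"
    using run by (simp add: method_run_def)
  have kK: "kbar w < K" if "w \<in> space M" for w
    using measurable_space[OF kb that] by simp
  have DX [measurable]: "(\<lambda>w. Dsym (X k w)) \<in> borel_measurable M" if "k < K" for k
    by (rule measurable_compose[OF measurable_X measurable_Dsym]) (use that in simp)
  \<comment> \<open>The output is a random selection; splitting it by the value of
    \<open>kbar\<close> reduces it to the deterministic indices.\<close>
  have Dsum: "?D w = (\<Sum>k<K. indicator {k} (kbar w) * Dsym (X k w))" if "w \<in> space M" for w
    using kK[OF that] by (subst sum.remove[of _ "kbar w"]) (auto intro!: sum.neutral)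
  have ind [measurable]: "(\<lambda>w. indicator {k} (kbar w) :: real) \<in> borel_measurable M" for k
    by (rule measurable_compose[OF kb]) simp
  have "(\<lambda>w. \<Sum>k<K. indicator {k} (kbar w) * Dsym (X k w)) \<in> borel_measurable M"
    by (intro borel_measurable_sum borel_measurable_times ind DX) simp
  then have Dm: "?D \<in> borel_measurable M" by (subst measurable_cong[OF Dsum])
  have "(\<integral>\<^sup>+w. ennreal (?D w) \<partial>M) = (\<integral>\<^sup>+w. (\<Sum>k<K. ?d k w) \<partial>M)"
  proof (rule nn_integral_cong)
    fix w assume w: "w \<in> space M"
    show "ennreal (?D w) = (\<Sum>k<K. ?d k w)"
      using kK[OF w] by (subst sum.remove[of _ "kbar w"]) (auto intro!: sum.neutral simp: sum.neutral)
  qed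
  also have "\<dots> = (\<Sum>k<K. \<integral>\<^sup>+w. ?d k w \<partial>M)"
    by (intro nn_integral_sum borel_measurable_times_ennreal measurable_compose[OF DX measurable_ennreal]
        measurable_compose[OF kb]) auto
  also have "\<dots> = (\<Sum>k<K. ennreal (1 / real K) * (\<integral>\<^sup>+w. ennreal (Dsym (X k w)) \<partial>M))"
  proof (intro sum.cong refl nn_integral_kbar)
    fix k assume k: "k \<in> {..<K}"
    then have "X k \<in> borel_measurable (Past K)"
      by (intro measurable_from_subalg[OF subalgebra_Past_mono measurable_X_Past]) auto
    then show "(\<lambda>w. ennreal (Dsym (X k w))) \<in> borel_measurable (Past K)"
      by (intro measurable_compose[OF _ measurable_ennreal] measurable_compose[OF _ measurable_Dsym])
  qed auto
  finally have "(\<integral>\<^sup>+w. ennreal (?D w) \<partial>M) = ennreal (1 / real K) * (\<Sum>k<K. \<integral>\<^sup>+w. ennreal (Dsym (X k w)) \<partial>M)"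
    by (simp add: sum_distrib_left)
  \<comment> \<open>The positive finite factor \<open>rate * real K\<close> is inserted to match the
    telescoped sum and is divided out afterwards by its reciprocal.\<close>
  then have "ennreal (rate * real K) * (\<integral>\<^sup>+w. ennreal (?D w) \<partial>M)
    = ennreal (rate * real K * (1 / real K)) * (\<Sum>k<K. \<integral>\<^sup>+w. ennreal (Dsym (X k w)) \<partial>M)"
    using rate by (simp only: ennreal_mult' mult.assoc[symmetric] mult_nonneg_nonneg less_imp_le of_nat_0_le_iff)
  also have "\<dots> = (\<Sum>k<K. \<integral>\<^sup>+w. ennreal (rate * Dsym (X k w)) \<partial>M)"
    using rate Kpos DX by (simp add: sum_distrib_left ennreal_mult' nn_integral_cmult)
  also have "\<dots> \<le> (\<integral>\<^sup>+w. ennreal (env (X K w) - Finf) \<partial>M) + \<dots>" by simp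
  also have "\<dots> \<le> ennreal (env x0 - Finf) + of_nat K * ennreal noise"
    using rate by (intro nn_integral_telescope) auto
  also have "\<dots> = ennreal (env x0 - Finf + real K * noise)"
    using Finf_le_env[of x0] noise_nonneg by (simp add: ennreal_mult ennreal_of_nat_eq_real_of_nat)
  finally have "ennreal (1 / (rate * real K)) * (ennreal (rate * real K) * (\<integral>\<^sup>+w. ennreal (?D w) \<partial>M))
      \<le> ennreal (1 / (rate * real K)) * ennreal (env x0 - Finf + real K * noise)"
    by (rule mult_left_mono) simp
  then have le: "(\<integral>\<^sup>+w. ennreal (?D w) \<partial>M) \<le> ennreal (1 / (rate * real K) * (env x0 - Finf + real K * noise))"
    using rate Kpos by (simp add: mult.assoc[symmetric] ennreal_mult'[symmetric])
  show int: "integrable M ?D"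
    using le Dm by (intro integrableI_nonneg) (auto simp: Dsym_nonneg le_less_trans)
  have "(LINT w|M. ?D w) = enn2real (\<integral>\<^sup>+w. ennreal (?D w) \<partial>M)"
    by (rule integral_eq_nn_integral[OF Dm]) (simp add: Dsym_nonneg)
  also have "\<dots> \<le> 1 / (rate * real K) * (env x0 - Finf + real K * noise)"
    using le rate Kpos Finf_le_env[of x0] noise_nonneg by (intro enn2real_leI) (auto intro!: mult_nonneg_nonneg add_nonneg_nonneg)
  also have "\<dots> = (env x0 - Finf) / (rate * real K) + noise / rate"
    using rate Kpos by (simp add: field_simps)
  finally show "(LINT w|M. ?D w) \<le> (env x0 - Finf) / (rate * real K) + noise / rate" .
qed

end

section \<open>Step-size arithmetic and the final bounds\<close>

lemma stepsize_identity:
  fixes c t lam \<rho> \<tau> \<Gamma> :: real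
  assumes "0 < c" "0 < 1 - t * \<rho>"
    and "\<Gamma> = (1 / c) * (t * (1 - lam * (\<rho> + \<tau>)) / (1 - t * \<rho>) - lam * (1 - c))"
  shows "c * (1 - t * \<rho>) * \<Gamma> = t * (1 - lam * (\<rho> + \<tau>)) - lam * (1 - c) * (1 - t * \<rho>)"
proof -
  define q A where "q = 1 - t * \<rho>" and "A = t * (1 - lam * (\<rho> + \<tau>))"
  have "c * q * \<Gamma> = q * (A / q - lam * (1 - c))"
    using assms(1) by (simp add: assms(3) q_def A_def)
  also have "\<dots> = A - lam * (1 - c) * q"
    using assms(2)[folded q_def] by (simp add: right_diff_distrib ac_simps)
  finally show ?thesis unfolding q_def A_def .
qed

text \<open>Hypothesis \<open>G\<close> states that at least half of \<open>t * a\<close> survives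
  the loss. The first summand uses \<open>t * a / 2 \<le> \<Gamma>\<close>, which follows because
  \<open>c * (1 - t * \<rho>)\<close> is at most \<open>1\<close>; the second keeps the product
  \<open>c * (1 - t * \<rho>) * \<Gamma>\<close> together and applies \<open>G\<close>
  directly.\<close>

lemma sqrt_stepsize_bound:
  fixes c t lam \<rho> L \<Delta> a \<Gamma> k :: real
  assumes pos: "0 < c" "c \<le> 1" "0 < \<rho>" "0 < lam" "0 < a" "1 < k" "0 \<le> \<Delta>" and t: "t = 1 / (\<rho> * sqrt k)"
    and G: "t * a / 2 \<le> c * (1 - t * \<rho>) * \<Gamma>"
  shows "\<Delta> / (\<Gamma> * k) + t\<^sup>2 * L\<^sup>2 / (4 * lam * c * (1 - t * \<rho>)) / \<Gamma>
    \<le> 1 / sqrt k * (2 * \<rho> * \<Delta> / a + L\<^sup>2 / (2 * lam * \<rho> * a))"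
proof -
  define s where "s = sqrt k"
  have s: "1 < s" "k = s * s" using pos by (simp_all add: s_def)
  have t': "t = 1 / (\<rho> * s)" by (simp add: t s_def)
  have t_pos: "0 < t" using pos s by (simp add: t')
  have trho: "t * \<rho> = 1 / s" using pos s by (simp add: t')
  have u: "0 < 1 - t * \<rho>" "1 - t * \<rho> < 1" using s by (simp_all add: trho)
  have "0 < t * a / 2" using t_pos pos by simp
  with G have "0 < c * (1 - t * \<rho>) * \<Gamma>" by linarith
  then have \<Gamma>: "0 < \<Gamma>" by (rule zero_less_mult_pos) (use pos u in auto)
  have "c * (1 - t * \<rho>) * \<Gamma> \<le> 1 * \<Gamma>"
    using pos u \<Gamma> by (intro mult_right_mono mult_le_one) auto
  then have "t * a / 2 \<le> \<Gamma>" using G by simp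
  then have "\<Delta> / (\<Gamma> * k) \<le> \<Delta> / (t * a / 2 * k)"
    using pos t_pos \<Gamma> by (intro divide_left_mono mult_right_mono mult_pos_pos) auto
  also have "\<dots> = 1 / s * (2 * \<rho> * \<Delta> / a)"
    using pos s by (simp add: t' field_simps)
  finally have 1: "\<Delta> / (\<Gamma> * k) \<le> 1 / s * (2 * \<rho> * \<Delta> / a)" .
  have "t\<^sup>2 * L\<^sup>2 / (4 * lam * c * (1 - t * \<rho>)) / \<Gamma> = t\<^sup>2 * L\<^sup>2 / (4 * lam * (c * (1 - t * \<rho>) * \<Gamma>))"
    by (simp add: mult.assoc)
  also have "\<dots> \<le> t\<^sup>2 * L\<^sup>2 / (4 * lam * (t * a / 2))"
    using pos t_pos u \<Gamma> G by (intro divide_left_mono mult_left_mono mult_pos_pos) auto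
  also have "\<dots> = t * (L\<^sup>2 / (2 * lam * a))"
    using pos t_pos by (simp add: field_simps power2_eq_square)
  also have "\<dots> = 1 / s * (L\<^sup>2 / (2 * lam * \<rho> * a))"
    by (simp add: t' ac_simps)
  finally show ?thesis using 1 by (simp add: s_def distrib_left)
qed

text \<open>Integrability of \<open>D\<close> is part of both conclusions because the Bochner
  integral of a function that is not integrable is \<open>0\<close>, which would make the bound void
  of content.\<close>

theorem theorem4p1:
  fixes P :: "'a measure" and M :: "'w measure"
    and fs :: "real ^ 'd \<Rightarrow> 'a \<Rightarrow> real" and fm :: "real ^ 'd \<Rightarrow> real ^ 'd \<Rightarrow> 'a \<Rightarrow> real"
    and r F :: "real ^ 'd \<Rightarrow> ereal" and \<omega> :: "real ^ 'd \<Rightarrow> real"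
    and \<omega>t :: "real ^ 'd \<Rightarrow> 'a \<Rightarrow> real" and gt :: "real ^ 'd \<Rightarrow> 'a \<Rightarrow> real ^ 'd"
    and \<rho> \<tau> L lam t \<Gamma> :: real and c :: "nat \<Rightarrow> real" and K m :: nat and x0 :: "real ^ 'd"
    and \<xi> :: "nat \<Rightarrow> nat \<Rightarrow> 'w \<Rightarrow> 'a" and X :: "nat \<Rightarrow> 'w \<Rightarrow> real ^ 'd" and kbar :: "'w \<Rightarrow> nat"
    and D :: "'w \<Rightarrow> real"
  assumes "setting P fs fm r \<omega>"
    and "basic_conditions P fs fm r \<omega> \<omega>t gt \<rho> \<tau>"
    and "composite_lipschitz P fm r \<omega>t gt L"
    and F: "F = total_obj P fs r"
    and "0 < lam" "lam < 1 / (\<rho> + \<tau>)"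
    and "1 \<le> K" "x0 \<in> edom r"
    and "method_run P fm r \<omega>t gt (\<lambda>_. t) (\<lambda>_. m) K x0 M \<xi> X kbar"
    and "bregman_lower_bound P F \<omega> \<omega>t gt lam c (\<lambda>_. m) K M \<xi> X"
    and \<Gamma>: "\<Gamma> = (1 / c m) * (t * (1 - lam * (\<rho> + \<tau>)) / (1 - t * \<rho>) - lam * (1 - c m))"
    and D: "D = (\<lambda>w. bregman_sym \<omega> lam (bregman_prox \<omega> lam F (X (kbar w) w)) (X (kbar w) w))"
  shows "(lam * (1 - c m) / (1 - lam * \<tau> - lam * \<rho> * c m) < t \<and> t < 1 / \<rho> \<longrightarrow>
      integrable M D \<and>
      ereal (LINT w|M. D w) \<le>
        (bregman_env \<omega> lam F x0 - (INF x. F x)) / ereal (\<Gamma> * real K)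
        + ereal (t\<^sup>2 * L\<^sup>2 / (4 * lam * c m * (1 - t * \<rho>) * \<Gamma>))) \<and>
    (1 < K \<and> t = 1 / (\<rho> * sqrt (real K)) \<and>
     1 - c m \<le> (1 - lam * (\<rho> + \<tau>)) / (2 * lam * \<rho> * sqrt (real K)) \<longrightarrow>
      integrable M D \<and>
      ereal (LINT w|M. D w) \<le>
        ereal (1 / sqrt (real K)) *
          (ereal (2 * \<rho>) * (bregman_env \<omega> lam F x0 - (INF x. F x))
             / ereal (1 - lam * (\<rho> + \<tau>))
           + ereal (L\<^sup>2 / (2 * lam * \<rho> * (1 - lam * (\<rho> + \<tau>))))))"
proof -
  interpret stochastic_model P fs fm r \<omega> \<omega>t gt \<rho> \<tau> L lam
    by unfold_locales fact+
  define a where "a = 1 - lam * (\<rho> + \<tau>)"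
  have a: "0 < a" using assms(6) rho_pos tau_pos lam_pos by (simp add: a_def field_simps)
  have c: "0 < c m" "c m \<le> 1" using assms(10) by (auto simp: bregman_lower_bound_def)
  have t: "0 < t" using assms(7,9) unfolding method_run_def by force
  have bound: "integrable M D \<and> (LINT w|M. D w)
      \<le> (env x0 - Finf) / (\<Gamma> * real K) + t\<^sup>2 * L\<^sup>2 / (4 * lam * c m * (1 - t * \<rho>)) / \<Gamma>"
    if "0 < \<Gamma>" "t < 1 / \<rho>"
  proof -
    interpret run: stochastic_run P fs fm r \<omega> \<omega>t gt \<rho> \<tau> L lam M \<xi> X kbar t m K x0 c
      using assms(7-10) that(2) by unfold_locales (simp_all add: F)
    have "\<Gamma> = run.rate" by (simp add: \<Gamma> run.rate_def)
    then show ?thesis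
      using run.expected_Dsym_bound that(1) by (simp add: D F run.noise_def)
  qed
  have trho: "0 < 1 - t * \<rho>" if "t < 1 / \<rho>"
    using that rho_pos by (simp add: field_simps)
  \<comment> \<open>With positive factors in front of \<Gamma>, its sign and its lower bounds can be
    read off free of denominators.\<close>
  have \<Gamma>_eq: "c m * (1 - t * \<rho>) * \<Gamma> = t * a - lam * (1 - c m) * (1 - t * \<rho>)" if "t < 1 / \<rho>"
    unfolding a_def by (rule stepsize_identity[OF c(1) trho[OF that] \<Gamma>])
  have env: "bregman_env \<omega> lam F x0 - (INF x. F x) = ereal (env x0 - Finf)"
    by (simp add: F bregman_env_eq INF_F)
  show ?thesis
  proof (intro conjI[of "_ \<longrightarrow> _"] impI)
    assume *: "lam * (1 - c m) / (1 - lam * \<tau> - lam * \<rho> * c m) < t \<and> t < 1 / \<rho>"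
    have "lam * \<rho> * c m \<le> lam * \<rho>" using lam_pos rho_pos c by simp
    then have "0 < 1 - lam * \<tau> - lam * \<rho> * c m"
      using a unfolding a_def by (simp add: distrib_left)
    then have "lam * (1 - c m) < t * (1 - lam * \<tau> - lam * \<rho> * c m)"
      using * by (simp add: pos_divide_less_eq)
    \<comment> \<open>Thus the lower bound on \<open>t\<close> says exactly that the right-hand side
      of \<open>\<Gamma>_eq\<close> is positive.\<close>
    also have "\<dots> = t * a + lam * (1 - c m) * (t * \<rho>)" by (simp add: a_def algebra_simps)
    finally have "0 < c m * (1 - t * \<rho>) * \<Gamma>"
      using \<Gamma>_eq * by (simp add: right_diff_distrib)
    then have \<Gamma>_pos: "0 < \<Gamma>" by (rule zero_less_mult_pos) (use c trho * in auto)
    show "integrable M D \<and> ereal (LINT w|M. D w)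
      \<le> (bregman_env \<omega> lam F x0 - (INF x. F x)) / ereal (\<Gamma> * real K)
        + ereal (t\<^sup>2 * L\<^sup>2 / (4 * lam * c m * (1 - t * \<rho>) * \<Gamma>))"
      using bound[OF \<Gamma>_pos] * \<Gamma>_pos assms(7) unfolding env by auto
  next
    assume *: "1 < K \<and> t = 1 / (\<rho> * sqrt (real K)) \<and>
     1 - c m \<le> (1 - lam * (\<rho> + \<tau>)) / (2 * lam * \<rho> * sqrt (real K))"
    have "1 < sqrt (real K)" using * by simp
    then have t_less: "t < 1 / \<rho>" using * rho_pos by (simp add: field_simps)
    \<comment> \<open>As \<open>\<rho> * sqrt (real K)\<close> is \<open>1 / t\<close>, the
      batch-size condition lets the loss consume at most half of \<open>t * a\<close>.\<close>
    have "1 - c m \<le> t * a / 2 / lam" using * by (simp add: a_def ac_simps)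
    then have "lam * (1 - c m) \<le> t * a / 2" using lam_pos by (simp add: field_simps)
    moreover have "lam * (1 - c m) * (1 - t * \<rho>) \<le> lam * (1 - c m)"
      using lam_pos c t rho_pos trho[OF t_less] by (intro mult_left_le) auto
    ultimately have G: "t * a / 2 \<le> c m * (1 - t * \<rho>) * \<Gamma>"
      unfolding \<Gamma>_eq[OF t_less] by linarith
    moreover have "0 < t * a / 2" using t a by simp
    ultimately have "0 < c m * (1 - t * \<rho>) * \<Gamma>" by linarith
    then have \<Gamma>_pos: "0 < \<Gamma>" by (rule zero_less_mult_pos) (use c trho[OF t_less] in auto)
    have "(env x0 - Finf) / (\<Gamma> * real K) + t\<^sup>2 * L\<^sup>2 / (4 * lam * c m * (1 - t * \<rho>)) / \<Gamma>
      \<le> 1 / sqrt (real K) * (2 * \<rho> * (env x0 - Finf) / a + L\<^sup>2 / (2 * lam * \<rho> * a))"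
      using c rho_pos lam_pos a * Finf_le_env[of x0] G by (intro sqrt_stepsize_bound) auto
    with bound[OF \<Gamma>_pos t_less] a show "integrable M D \<and> ereal (LINT w|M. D w) \<le>
        ereal (1 / sqrt (real K)) *
          (ereal (2 * \<rho>) * (bregman_env \<omega> lam F x0 - (INF x. F x))
             / ereal (1 - lam * (\<rho> + \<tau>))
           + ereal (L\<^sup>2 / (2 * lam * \<rho> * (1 - lam * (\<rho> + \<tau>)))))"
      unfolding env a_def[symmetric] by simp
  qed
qed

end
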